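(* Let $(p_n)_{n=1}^\infty$ be a guided sequence of polynomials for which there is a non-empty open set $D\subset\mathbb{C}$ such that $\sup_{n\geq 1}\frac{1}{\deg p_n}\log^+|p_n(z)|<+\infty$ for every $z\in D$. Then for every compact, regular and polynomially convex set $E\subset\mathbb{C}$ the function sequence $\left(g_{(p_n\circ\dots\circ p_1)^{-1}(E)}\right)_{n=1}^\infty$ converges to $g_{\mathcal{K}[(p_n)_{n=1}^\infty]}$ uniformly in $\mathbb{C}$. In particular the function sequence $$\left(\frac{1}{\deg p_n\cdot\ldots\cdot\deg p_1}\log^+\left|p_n\circ\dots\circ p_1\right|\right)_{n=1}^\infty$$ is uniformly convergent in $\mathbb{C}$.
   Context: Notation: $\overline{\mathbb{D}}(a,R)=\{z\in\mathbb{C}:|z-a|\leq R\}$ and $\log^+ x=\max\{0,\log x\}$ (with $\log^+0=0$). Guided sequence: a sequence of complex polynomials $(p_n)_{n=1}^\infty$ with $\deg p_1\geq 1$ and $\deg p_n\geq 2$ for $n\geq 2$ is called guided if, with $\alpha:=\limsup_{n\to\infty}\frac{1}{\deg p_n}$, there exist an $r>0$ and a function $h:\mathbb{C}\to\mathbb{R}$ satisfying $h(z)-\alpha\log|z|\to\infty$ as $|z|\to\infty$ such that (i) $\bigcup_{n=1}^\infty p_n^{-1}(0)\subset\overline{\mathbb{D}}(0,r)$; (ii) there exists $N>1$ such that $\frac{1}{\deg p_n}\log^+|p_n(\zeta)|>h(\zeta)$ for all $n\geq N$ and all $\zeta\in\mathbb{C}\setminus\overline{\mathbb{D}}(0,r)$.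 The (non-autonomous) filled Julia set of $(p_n)_{n=1}^\infty$ is $\mathcal{K}[(p_n)_{n=1}^\infty]=\left\{z\in\mathbb{C}: \left((p_n\circ\dots\circ p_1)(z)\right)_{n=1}^\infty \text{ is bounded}\right\}$; under the stated hypotheses it is compact, regular and polynomially convex, so its Green function is defined. For compact $K\subset\mathbb{C}$ let $D_\infty^K$ be the unbounded component of $\mathbb{C}\setminus K$ and let $\widehat K=\mathbb{C}\setminus D_\infty^K$ be the polynomially convex hull; $K$ is polynomially convex if $K=\widehat K$. The Green function (with pole at infinity) of an unbounded domain $D\subset\mathbb{C}$ is, if it exists, the (unique) function $g_D:D\to\mathbb{R}$ that is harmonic and positive in $D$, satisfies $g_D(z)\to 0$ as $z\to\partial D$, and for which $g_D(z)-\log|z|$ tends to a finite number as $z\to\infty$. A compact set $K$ is regular if $g_{D_\infty^K}$ exists; then $g_K:\mathbb{C}\to\mathbb{R}$ is defined by $g_K=g_{D_\infty^K}$ on $D_\infty^K$ and $g_K=0$ on $\widehat K$. If $P$ is a non-constant polynomial and $E$ is compact, regular and polynomially convex, then so is $P^{-1}(E)$. *)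

theory Defs
  imports "HOL-Analysis.Analysis" "HOL-Computational_Algebra.Polynomial"
begin

(* The value at 0 is the convention "log^+ 0 = 0", fixed independently of the value of "ln 0". *)
definition log_plus :: "real \<Rightarrow> real" where
  "log_plus x = (if x = 0 then 0 else max 0 (ln x))"

(* C^2 with vanishing Laplacian; ux, uy are the first and uxx, uxy, uyx, uyy the second partial
   derivatives of u with respect to real and imaginary part. *)
definition harmonic_on :: "(complex \<Rightarrow> real) \<Rightarrow> complex set \<Rightarrow> bool" where
  "harmonic_on u D \<longleftrightarrow> open D \<and>
     (\<exists>ux uy uxx uxy uyx uyy :: complex \<Rightarrow> real.
        continuous_on D uxx \<and> continuous_on D uxy \<and> continuous_on D uyx \<and> continuous_on D uyy \<and>
        (\<forall>z\<in>D. (u has_derivative (\<lambda>v. Re v * ux z + Im v * uy z)) (at z) \<and>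
               (ux has_derivative (\<lambda>v. Re v * uxx z + Im v * uxy z)) (at z) \<and>
               (uy has_derivative (\<lambda>v. Re v * uyx z + Im v * uyy z)) (at z) \<and>
               uxx z + uyy z = 0))"

(* g restricted to D is the Green function with pole at infinity of the unbounded domain D.
   The values of g off D are irrelevant. *)
definition is_green_function :: "complex set \<Rightarrow> (complex \<Rightarrow> real) \<Rightarrow> bool" where
  "is_green_function D g \<longleftrightarrow>
     harmonic_on g D \<and> (\<forall>z\<in>D. g z > 0) \<and>
     (\<forall>\<zeta>\<in>frontier D. (g \<longlongrightarrow> 0) (at \<zeta> within D)) \<and>
     (\<exists>c. ((\<lambda>z. g z - ln (norm z)) \<longlongrightarrow> c) (inf at_infinity (principal D)))"

(* For compact K the complement of K has exactly one unbounded component, which is "outside K"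
   in the library; hence "- outside K" is the polynomially convex hull of K. *)
definition poly_hull :: "complex set \<Rightarrow> complex set" where
  "poly_hull K = - outside K"

definition polynomially_convex :: "complex set \<Rightarrow> bool" where
  "polynomially_convex K \<longleftrightarrow> K = poly_hull K"

definition regular_set :: "complex set \<Rightarrow> bool" where
  "regular_set K \<longleftrightarrow> compact K \<and> (\<exists>g. is_green_function (outside K) g)"

(* Meaningful for regular K only. *)
definition green :: "complex set \<Rightarrow> complex \<Rightarrow> real" where
  "green K = (THE g. is_green_function (outside K) g \<and> (\<forall>z\<in>poly_hull K. g z = 0))"

(* Sequences of polynomials are indexed from 1; the entry p 0 is never used. *)
definition guided :: "(nat \<Rightarrow> complex poly) \<Rightarrow> bool" where
  "guided p \<longleftrightarrow>
     degree (p 1) \<ge> 1 \<and> (\<forall>n\<ge>2. degree (p n) \<ge> 2) \<and>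
     (let \<alpha> = real_of_ereal (limsup (\<lambda>n. ereal (1 / real (degree (p n))))) in
      \<exists>(r::real) (h :: complex \<Rightarrow> real).
        r > 0 \<and>
        filterlim (\<lambda>z. h z - \<alpha> * ln (norm z)) at_top at_infinity \<and>
        (\<Union>n\<in>{1..}. {z. poly (p n) z = 0}) \<subseteq> cball 0 r \<and>
        (\<exists>N>1. \<forall>n\<ge>N. \<forall>\<zeta>\<in>- cball 0 r.
            1 / real (degree (p n)) * log_plus (norm (poly (p n) \<zeta>)) > h \<zeta>))"

(* compos p n is the composition p_n o ... o p_1. *)
primrec compos :: "(nat \<Rightarrow> complex poly) \<Rightarrow> nat \<Rightarrow> complex \<Rightarrow> complex" where
  "compos p 0 = id"
| "compos p (Suc n) = poly (p (Suc n)) \<circ> compos p n"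

definition filled_julia :: "(nat \<Rightarrow> complex poly) \<Rightarrow> complex set" where
  "filled_julia p = {z. bounded ((\<lambda>n. compos p n z) ` {1..})}"

end

theory Submission
  imports Defs "HOL-Complex_Analysis.Complex_Analysis"
    "HOL-Computational_Algebra.Fundamental_Theorem_Algebra"
begin

text \<open>
  Let \<open>P\<^sub>n\<close> be the composition of the first \<open>n\<close> polynomials, \<open>D\<^sub>n\<close> its degree, and
  \<open>u\<^sub>n = log\<^sup>+ |P\<^sub>n| / D\<^sub>n\<close>. Everything rests on one estimate for the single polynomials: there is a
  constant \<open>C\<close> such that, for all \<open>n\<close> and all \<open>w\<close>,
  \<open>log\<^sup>+ |p\<^sub>n(w)| / deg p\<^sub>n\<close> differs from \<open>log\<^sup>+ |w|\<close> by at most \<open>C\<close>. Substituting \<open>w = P\<^sub>n(z)\<close> turns it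
  into \<open>|u\<^sub>n\<^sub>+\<^sub>1 - u\<^sub>n| \<le> C / D\<^sub>n\<close>, and since \<open>D\<^sub>n\<close> at least doubles with every step after the first, \<open>u\<^sub>n\<close> converges
  uniformly on the plane to a function \<open>g\<close> with \<open>|g - u\<^sub>n| \<le> 2 C / D\<^sub>n\<close>.

  For a polynomial of degree \<open>d\<close> with all its zeros in a fixed disc, \<open>log |p(w)|\<close> is, well outside
  this disc, \<open>log |a| + d log |w|\<close> up to an error of order \<open>d\<close>, where \<open>a\<close> is the leading coefficient. So the
  estimate says that \<open>log |a\<^sub>n| / deg p\<^sub>n\<close> is bounded. A bound from below comes from the guiding
  function at one point where it is nonnegative (\<open>guided_lead_coeff_lower_bound\<close>). For a bound from
  above, Baire's theorem improves pointwise boundedness on the open set to a uniform bound on some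
  disc, and the maximum principle for the reversed polynomial passes it on to the leading coefficient
  (\<open>pointwise_bounded_lead_coeff_upper_bound\<close>).

  The limit \<open>g\<close> vanishes exactly where the orbit is bounded. Where \<open>g\<close> is positive, \<open>u\<^sub>n\<close> is,
  locally and for large \<open>n\<close>, the real part of a holomorphic function, so that \<open>g\<close> is harmonic there; and
  \<open>g(z) - log |z|\<close> has a limit at infinity because every \<open>u\<^sub>n\<close> has this property and the convergence
  is uniform. By the maximum principle these properties characterise the Green function of the zero
  set (\<open>green_like_imp_green\<close>), so that \<open>g\<close> is the Green function of the filled Julia set. The same
  characterisation shows that the Green function of the preimage of \<open>E\<close> under \<open>P\<^sub>n\<close> is
  \<open>g\<^sub>E \<circ> P\<^sub>n / D\<^sub>n\<close>. Since \<open>g\<^sub>E - log\<^sup>+\<close> is bounded on the plane, this function differs from \<open>u\<^sub>n\<close> by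
  \<open>O(1 / D\<^sub>n)\<close> and has the same limit \<open>g\<close>.
\<close>

section \<open>Harmonic functions and the maximum principle\<close>

lemma harmonic_on_imp_continuous_on:
  assumes "harmonic_on u D"
  shows "continuous_on D u"
proof -
  have "isCont u z" if "z \<in> D" for z
    using assms that unfolding harmonic_on_def by (blast dest: has_derivative_continuous)
  then show ?thesis
    by (simp add: continuous_at_imp_continuous_on)
qed

lemma harmonic_on_cong:
  assumes "harmonic_on u D" "\<And>z. z \<in> D \<Longrightarrow> v z = u z"
  shows "harmonic_on v D"
proof -
  have *: "(v has_derivative f) (at z)" if "(u has_derivative f) (at z)" "z \<in> D" for f z
    using has_derivative_transform_within_open[of u f z UNIV D v] that assms
    unfolding harmonic_on_def by auto
  show ?thesis
    using assms(1) * unfolding harmonic_on_def by blast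
qed

lemma harmonic_on_lincomb:
  assumes "harmonic_on u D" "harmonic_on v D"
  shows "harmonic_on (\<lambda>z. a * u z + b * v z) D"
proof -
  from assms(1) obtain ux uy uxx uxy uyx uyy where D: "open D" and
    u: "continuous_on D uxx" "continuous_on D uxy" "continuous_on D uyx" "continuous_on D uyy"
      "\<And>z. z \<in> D \<Longrightarrow> (u has_derivative (\<lambda>v. Re v * ux z + Im v * uy z)) (at z)"
      "\<And>z. z \<in> D \<Longrightarrow> (ux has_derivative (\<lambda>v. Re v * uxx z + Im v * uxy z)) (at z)"
      "\<And>z. z \<in> D \<Longrightarrow> (uy has_derivative (\<lambda>v. Re v * uyx z + Im v * uyy z)) (at z)"
      "\<And>z. z \<in> D \<Longrightarrow> uxx z + uyy z = 0"
    unfolding harmonic_on_def by blast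
  from assms(2) obtain vx vy vxx vxy vyx vyy where
    v: "continuous_on D vxx" "continuous_on D vxy" "continuous_on D vyx" "continuous_on D vyy"
      "\<And>z. z \<in> D \<Longrightarrow> (v has_derivative (\<lambda>w. Re w * vx z + Im w * vy z)) (at z)"
      "\<And>z. z \<in> D \<Longrightarrow> (vx has_derivative (\<lambda>w. Re w * vxx z + Im w * vxy z)) (at z)"
      "\<And>z. z \<in> D \<Longrightarrow> (vy has_derivative (\<lambda>w. Re w * vyx z + Im w * vyy z)) (at z)"
      "\<And>z. z \<in> D \<Longrightarrow> vxx z + vyy z = 0"
    unfolding harmonic_on_def by blast
  have der: "((\<lambda>z. a * f z + b * g z) has_derivative
          (\<lambda>w. Re w * (a * fx + b * gx) + Im w * (a * fy + b * gy))) (at z)"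
    if "(f has_derivative (\<lambda>w. Re w * fx + Im w * fy)) (at z)"
       "(g has_derivative (\<lambda>w. Re w * gx + Im w * gy)) (at z)"
    for f g :: "complex \<Rightarrow> real" and fx fy gx gy z
    by (rule derivative_eq_intros that | simp add: algebra_simps)+
  show ?thesis
    unfolding harmonic_on_def
  proof (intro conjI exI ballI)
    fix z assume z: "z \<in> D"
    show "((\<lambda>z. a * u z + b * v z) has_derivative
            (\<lambda>w. Re w * (a * ux z + b * vx z) + Im w * (a * uy z + b * vy z))) (at z)"
      by (rule der[OF u(5)[OF z] v(5)[OF z]])
    show "((\<lambda>z. a * ux z + b * vx z) has_derivative
            (\<lambda>w. Re w * (a * uxx z + b * vxx z) + Im w * (a * uxy z + b * vxy z))) (at z)"
      by (rule der[OF u(6)[OF z] v(6)[OF z]])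
    show "((\<lambda>z. a * uy z + b * vy z) has_derivative
            (\<lambda>w. Re w * (a * uyx z + b * vyx z) + Im w * (a * uyy z + b * vyy z))) (at z)"
      by (rule der[OF u(7)[OF z] v(7)[OF z]])
    have "(a * uxx z + b * vxx z) + (a * uyy z + b * vyy z) = a * (uxx z + uyy z) + b * (vxx z + vyy z)"
      by (simp add: algebra_simps)
    then show "(a * uxx z + b * vxx z) + (a * uyy z + b * vyy z) = 0"
      using u(8)[OF z] v(8)[OF z] by simp
  qed (intro D continuous_intros u v)+
qed

text \<open>
  By the Cauchy-Riemann equations \<open>f' = a + \<i> b\<close> determines both partial derivatives of \<open>f\<close>; in the
  Laplacian of the composition the terms with second derivatives of \<open>f\<close> and those with mixed second
  derivatives of \<open>u\<close> cancel, which leaves \<open>|f'|\<^sup>2\<close> times the Laplacian of \<open>u\<close>.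
\<close>

lemma harmonic_on_compose_holomorphic:
  assumes "harmonic_on u S" "f holomorphic_on T" "open T" "f ` T \<subseteq> S"
  shows "harmonic_on (\<lambda>z. u (f z)) T"
proof -
  from assms(1) obtain ux uy uxx uxy uyx uyy where
    u: "continuous_on S uxx" "continuous_on S uxy" "continuous_on S uyx" "continuous_on S uyy"
      "\<And>z. z \<in> S \<Longrightarrow> (u has_derivative (\<lambda>v. Re v * ux z + Im v * uy z)) (at z)"
      "\<And>z. z \<in> S \<Longrightarrow> (ux has_derivative (\<lambda>v. Re v * uxx z + Im v * uxy z)) (at z)"
      "\<And>z. z \<in> S \<Longrightarrow> (uy has_derivative (\<lambda>v. Re v * uyx z + Im v * uyy z)) (at z)"
      "\<And>z. z \<in> S \<Longrightarrow> uxx z + uyy z = 0"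
    unfolding harmonic_on_def by blast
  define a b a' b' where ab: "a = (\<lambda>z. Re (deriv f z))" "b = (\<lambda>z. Im (deriv f z))"
    "a' = (\<lambda>z. Re (deriv (deriv f) z))" "b' = (\<lambda>z. Im (deriv (deriv f) z))"
  have hol: "deriv f holomorphic_on T" "deriv (deriv f) holomorphic_on T"
    using assms(2,3) by (auto intro: holomorphic_deriv)
  have cf: "continuous_on T f" and cont: "continuous_on T a" "continuous_on T b"
      "continuous_on T a'" "continuous_on T b'"
    unfolding ab using hol assms(2)
    by (auto intro!: continuous_intros holomorphic_on_imp_continuous_on)
  have cS: "continuous_on T (\<lambda>z. h (f z))" if "continuous_on S h" for h :: "complex \<Rightarrow> real"
    by (rule continuous_on_compose2[OF that cf assms(4)])
  have df: "(f has_derivative (\<lambda>v. deriv f z * v)) (at z)"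
       "(deriv f has_derivative (\<lambda>v. deriv (deriv f) z * v)) (at z)" if "z \<in> T" for z
    using assms(2,3) hol(1) that holomorphic_derivI unfolding has_field_derivative_def by blast+
  have da: "(a has_derivative (\<lambda>v. Re v * a' z + Im v * (- b' z))) (at z)"
       "(b has_derivative (\<lambda>v. Re v * b' z + Im v * a' z)) (at z)" if "z \<in> T" for z
    unfolding ab using has_derivative_Re[OF df(2)[OF that]] has_derivative_Im[OF df(2)[OF that]]
    by (simp_all add: algebra_simps)
  have chain: "((\<lambda>z. h (f z)) has_derivative
        (\<lambda>v. Re v * (a z * hx + b z * hy) + Im v * (a z * hy - b z * hx))) (at z)"
    if "(h has_derivative (\<lambda>v. Re v * hx + Im v * hy)) (at (f z))" "z \<in> T"
    for h :: "complex \<Rightarrow> real" and hx hy z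
    using has_derivative_compose[OF df(1)[OF that(2)] that(1)]
    by (simp add: ab algebra_simps)
  have mult_rule: "((\<lambda>z. h z * k z) has_derivative
        (\<lambda>v. Re v * (h z * kx + hx * k z) + Im v * (h z * ky + hy * k z))) (at z)"
    if "(h has_derivative (\<lambda>v. Re v * hx + Im v * hy)) (at z)"
       "(k has_derivative (\<lambda>v. Re v * kx + Im v * ky)) (at z)"
    for h k :: "complex \<Rightarrow> real" and hx hy kx ky z
    using has_derivative_mult[OF that] by (simp add: algebra_simps)
  have add_rule: "((\<lambda>z. h z + k z) has_derivative (\<lambda>v. Re v * (hx + kx) + Im v * (hy + ky))) (at z)"
    and diff_rule: "((\<lambda>z. h z - k z) has_derivative (\<lambda>v. Re v * (hx - kx) + Im v * (hy - ky))) (at z)"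
    if "(h has_derivative (\<lambda>v. Re v * hx + Im v * hy)) (at z)"
       "(k has_derivative (\<lambda>v. Re v * kx + Im v * ky)) (at z)"
    for h k :: "complex \<Rightarrow> real" and hx hy kx ky z
    using has_derivative_add[OF that] has_derivative_diff[OF that] by (simp_all add: algebra_simps)
  have uf: "continuous_on T (\<lambda>z. ux (f z))" "continuous_on T (\<lambda>z. uy (f z))"
    by (rule cS, rule continuous_at_imp_continuous_on,
        use u(6,7)[THEN has_derivative_continuous] in auto)+
  note cs = cS[OF u(1)] cS[OF u(2)] cS[OF u(3)] cS[OF u(4)] uf cont
  show ?thesis
    unfolding harmonic_on_def
  proof (intro conjI exI ballI)
    fix z assume z: "z \<in> T"
    then have fz: "f z \<in> S" using assms(4) by blast
    show "((\<lambda>z. u (f z)) has_derivative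
        (\<lambda>v. Re v * (a z * ux (f z) + b z * uy (f z)) + Im v * (a z * uy (f z) - b z * ux (f z)))) (at z)"
      by (rule chain[OF u(5)[OF fz] z])
    show "((\<lambda>z. a z * ux (f z) + b z * uy (f z)) has_derivative
        (\<lambda>v. Re v * (a z * (a z * uxx (f z) + b z * uxy (f z)) + a' z * ux (f z)
                    + (b z * (a z * uyx (f z) + b z * uyy (f z)) + b' z * uy (f z)))
           + Im v * (a z * (a z * uxy (f z) - b z * uxx (f z)) + - b' z * ux (f z)
                    + (b z * (a z * uyy (f z) - b z * uyx (f z)) + a' z * uy (f z))))) (at z)"
      by (intro add_rule mult_rule da[OF z] chain[OF u(6)[OF fz] z] chain[OF u(7)[OF fz] z])
    show "((\<lambda>z. a z * uy (f z) - b z * ux (f z)) has_derivative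
        (\<lambda>v. Re v * (a z * (a z * uyx (f z) + b z * uyy (f z)) + a' z * uy (f z)
                    - (b z * (a z * uxx (f z) + b z * uxy (f z)) + b' z * ux (f z)))
           + Im v * (a z * (a z * uyy (f z) - b z * uyx (f z)) + - b' z * uy (f z)
                    - (b z * (a z * uxy (f z) - b z * uxx (f z)) + a' z * ux (f z))))) (at z)"
      by (intro diff_rule mult_rule da[OF z] chain[OF u(6)[OF fz] z] chain[OF u(7)[OF fz] z])
    have "a z * (a z * uxx (f z) + b z * uxy (f z)) + a' z * ux (f z)
             + (b z * (a z * uyx (f z) + b z * uyy (f z)) + b' z * uy (f z))
          + (a z * (a z * uyy (f z) - b z * uyx (f z)) + - b' z * uy (f z)
             - (b z * (a z * uxy (f z) - b z * uxx (f z)) + a' z * ux (f z)))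
          = (a z * a z + b z * b z) * (uxx (f z) + uyy (f z))"
      by (simp add: algebra_simps)
    also have "\<dots> = 0" using u(8)[OF fz] by simp
    finally show "a z * (a z * uxx (f z) + b z * uxy (f z)) + a' z * ux (f z)
             + (b z * (a z * uyx (f z) + b z * uyy (f z)) + b' z * uy (f z))
          + (a z * (a z * uyy (f z) - b z * uyx (f z)) + - b' z * uy (f z)
             - (b z * (a z * uxy (f z) - b z * uxx (f z)) + a' z * ux (f z))) = 0" .
  qed (intro assms(3) continuous_intros cs)+
qed

lemma harmonic_on_subset:
  assumes "harmonic_on u D" "open U" "U \<subseteq> D"
  shows "harmonic_on u U"
  using harmonic_on_compose_holomorphic[OF assms(1) holomorphic_on_ident assms(2)] assms(3) by simp

lemma harmonic_on_Re:
  assumes "f holomorphic_on T" "open T"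
  shows "harmonic_on (\<lambda>z. Re (f z)) T"
proof -
  have "harmonic_on Re UNIV"
    unfolding harmonic_on_def
  proof (intro conjI exI ballI)
    show "(Re has_derivative (\<lambda>v. Re v * (\<lambda>_. 1) z + Im v * (\<lambda>_. 0) z)) (at z)" for z
      using has_derivative_Re[OF has_derivative_ident] by simp
    show "((\<lambda>_. 1) has_derivative (\<lambda>v. Re v * (\<lambda>_. 0) z + Im v * (\<lambda>_. 0) z)) (at z)"
         "((\<lambda>_. 0) has_derivative (\<lambda>v. Re v * (\<lambda>_. 0) z + Im v * (\<lambda>_. 0) z)) (at z)" 
         "(\<lambda>_. 0) z + (\<lambda>_. 0) z = (0::real)" for z :: complex
      by simp_all
  qed auto
  from harmonic_on_compose_holomorphic[OF this assms] show ?thesis by simp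
qed

text \<open>
  \<open>harmonic_on\<close> quantifies existentially over the partial derivatives on the whole domain. The
  canonical choice made here turns harmonicity into a property of single points, so that harmonic
  pieces can be glued.
\<close>

definition pdx :: "(complex \<Rightarrow> real) \<Rightarrow> complex \<Rightarrow> real" where
  "pdx u z = frechet_derivative u (at z) 1"

definition pdy :: "(complex \<Rightarrow> real) \<Rightarrow> complex \<Rightarrow> real" where
  "pdy u z = frechet_derivative u (at z) \<i>"

lemma pd_eqI:
  assumes "(u has_derivative (\<lambda>v. Re v * a + Im v * b)) (at z)"
  shows "pdx u z = a" "pdy u z = b"
  using frechet_derivative_at[OF assms, symmetric] by (simp_all add: pdx_def pdy_def)

definition harmonic_at :: "(complex \<Rightarrow> real) \<Rightarrow> complex \<Rightarrow> bool" where
  "harmonic_at u z \<longleftrightarrow>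
     isCont (pdx (pdx u)) z \<and> isCont (pdy (pdx u)) z \<and> isCont (pdx (pdy u)) z \<and> isCont (pdy (pdy u)) z \<and>
     (u has_derivative (\<lambda>v. Re v * pdx u z + Im v * pdy u z)) (at z) \<and>
     (pdx u has_derivative (\<lambda>v. Re v * pdx (pdx u) z + Im v * pdy (pdx u) z)) (at z) \<and>
     (pdy u has_derivative (\<lambda>v. Re v * pdx (pdy u) z + Im v * pdy (pdy u) z)) (at z) \<and>
     pdx (pdx u) z + pdy (pdy u) z = 0"

lemma harmonic_on_imp_harmonic_at:
  assumes "harmonic_on u U" "z \<in> U"
  shows "harmonic_at u z"
proof -
  from assms(1) obtain ux uy uxx uxy uyx uyy where U: "open U" and
    u: "continuous_on U uxx" "continuous_on U uxy" "continuous_on U uyx" "continuous_on U uyy"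
      "\<And>z. z \<in> U \<Longrightarrow> (u has_derivative (\<lambda>v. Re v * ux z + Im v * uy z)) (at z)"
      "\<And>z. z \<in> U \<Longrightarrow> (ux has_derivative (\<lambda>v. Re v * uxx z + Im v * uxy z)) (at z)"
      "\<And>z. z \<in> U \<Longrightarrow> (uy has_derivative (\<lambda>v. Re v * uyx z + Im v * uyy z)) (at z)"
      "\<And>z. z \<in> U \<Longrightarrow> uxx z + uyy z = 0"
    unfolding harmonic_on_def by blast
  have 1: "pdx u w = ux w" "pdy u w = uy w" if "w \<in> U" for w
    using pd_eqI[OF u(5)[OF that]] by simp_all
  have d2: "(pdx u has_derivative (\<lambda>v. Re v * uxx w + Im v * uxy w)) (at w)"
           "(pdy u has_derivative (\<lambda>v. Re v * uyx w + Im v * uyy w)) (at w)" if w: "w \<in> U" for w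
    by (rule has_derivative_transform_within_open[OF u(6)[OF w] U w], simp add: 1,
        rule has_derivative_transform_within_open[OF u(7)[OF w] U w], simp add: 1)
  note 2 = pd_eqI[OF d2(1)] pd_eqI[OF d2(2)]
  have c: "isCont h z" if "continuous_on U k" "\<And>w. w \<in> U \<Longrightarrow> h w = k w" for h k :: "complex \<Rightarrow> real"
    using that U assms(2) continuous_on_cong continuous_on_eq_continuous_at by metis
  show ?thesis
    unfolding harmonic_at_def
    using c[OF u(1) 2(1)] c[OF u(2) 2(2)] c[OF u(3) 2(3)] c[OF u(4) 2(4)]
      u(5)[OF assms(2)] d2[OF assms(2)] u(8)[OF assms(2)] 1[OF assms(2)] 2[OF assms(2)]
    by simp
qed

lemma harmonic_on_local:
  assumes "open D" "\<And>z. z \<in> D \<Longrightarrow> \<exists>U. z \<in> U \<and> harmonic_on u U"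
  shows "harmonic_on u D"
proof -
  have h: "harmonic_at u z" if "z \<in> D" for z
    using assms(2)[OF that] harmonic_on_imp_harmonic_at by blast
  show ?thesis
    unfolding harmonic_on_def
  proof (intro conjI exI ballI)
    show "open D" by (rule assms(1))
    show "continuous_on D (pdx (pdx u))" "continuous_on D (pdy (pdx u))"
         "continuous_on D (pdx (pdy u))" "continuous_on D (pdy (pdy u))"
      by (rule continuous_at_imp_continuous_on; use h in \<open>simp add: harmonic_at_def\<close>)+
    fix z assume "z \<in> D"
    note hz = h[OF this, unfolded harmonic_at_def]
    show "(u has_derivative (\<lambda>v. Re v * pdx u z + Im v * pdy u z)) (at z)"
         "(pdx u has_derivative (\<lambda>v. Re v * pdx (pdx u) z + Im v * pdy (pdx u) z)) (at z)"
         "(pdy u has_derivative (\<lambda>v. Re v * pdx (pdy u) z + Im v * pdy (pdy u) z)) (at z)"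
         "pdx (pdx u) z + pdy (pdy u) z = 0"
      using hz by blast+
  qed
qed

text \<open>
  If \<open>l\<close> were positive, the first derivative, which vanishes at \<open>0\<close>, would be positive right of \<open>0\<close>,
  and the mean value theorem would give a larger value there.
\<close>

lemma second_derivative_at_max_nonpos:
  fixes f f' :: "real \<Rightarrow> real"
  assumes d: "d > 0"
    and f: "\<And>t. \<bar>t\<bar> < d \<Longrightarrow> (f has_real_derivative f' t) (at t)"
    and f': "(f' has_real_derivative l) (at 0)"
    and le: "\<And>t. \<bar>t\<bar> < d \<Longrightarrow> f t \<le> f 0"
  shows "l \<le> 0"
proof (rule ccontr)
  assume "\<not> l \<le> 0"
  then obtain e where e: "e > 0" "\<And>h. 0 < h \<Longrightarrow> h < e \<Longrightarrow> f' 0 < f' h"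
    using DERIV_pos_inc_right[OF f'] by auto
  have "f' 0 = 0"
    by (rule DERIV_local_max[OF f[of 0] d]) (use d le in auto)
  define s where "s = min d e / 2"
  have s: "0 < s" "s < d" "s < e" using d e(1) by (auto simp: s_def)
  obtain z where z: "0 < z" "z < s" "f s - f 0 = (s - 0) * f' z"
    using MVT2[of 0 s f f'] f s by force
  then have "f s - f 0 > 0"
    using e(2)[of z] s \<open>f' 0 = 0\<close> by simp
  with le[of s] s show False by simp
qed

lemma has_real_derivative_along_line:
  assumes "(h has_derivative (\<lambda>v. Re v * a + Im v * b)) (at (x + t *\<^sub>R v))"
  shows "((\<lambda>t. h (x + t *\<^sub>R v)) has_real_derivative Re v * a + Im v * b) (at t)"
proof -
  have "((\<lambda>t. x + t *\<^sub>R v) has_derivative (\<lambda>s. s *\<^sub>R v)) (at t)"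
    by (auto intro!: derivative_eq_intros)
  from has_derivative_compose[OF this assms] show ?thesis
    by (rule has_derivative_imp_has_field_derivative) (simp add: algebra_simps)
qed

text \<open>
  The boundary conditions at the frontier and at infinity keep the set away from both, which makes it
  closed and bounded.
\<close>

lemma superlevel_set_compact:
  fixes u :: "complex \<Rightarrow> real"
  assumes cont: "continuous_on D u"
    and front: "\<And>\<zeta>. \<zeta> \<in> frontier D \<Longrightarrow> \<forall>\<^sub>F z in at \<zeta> within D. u z < e"
    and inf: "\<forall>\<^sub>F z in inf at_infinity (principal D). u z < e"
    and D: "open D"
  shows "compact {z \<in> D. e \<le> u z}"
proof -
  obtain R where "\<And>z. R \<le> norm z \<Longrightarrow> z \<in> D \<Longrightarrow> u z < e"
    using inf unfolding eventually_inf_principal eventually_at_infinity by blast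
  then have "{z \<in> D. e \<le> u z} \<subseteq> cball 0 R"
    by (force simp: not_less[symmetric])
  then have "bounded {z \<in> D. e \<le> u z}"
    using bounded_cball bounded_subset by blast
  moreover have "closed {z \<in> D. e \<le> u z}"
    unfolding closed_limpt
  proof (intro allI impI)
    fix z assume z: "z islimpt {z \<in> D. e \<le> u z}"
    show "z \<in> {z \<in> D. e \<le> u z}"
    proof (cases "z \<in> D")
      case True
      have "\<not> u z < e"
      proof
        assume "u z < e"
        moreover have "u \<midarrow>z\<rightarrow> u z"
          using cont D True by (simp add: continuous_on_eq_continuous_at isCont_def)
        ultimately have "\<forall>\<^sub>F w in at z. u w < e"
          by (rule order_tendstoD(2)[rotated])
        then have "\<forall>\<^sub>F w in at z. \<not> (w \<in> D \<and> e \<le> u w)"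
          by eventually_elim auto
        with z show False
          unfolding islimpt_iff_eventually by auto
      qed
      with True show ?thesis by auto
    next
      case False
      have "z islimpt D" by (rule islimpt_subset[OF z]) auto
      then have "z \<in> frontier D"
        using False D by (simp add: frontier_def closure_def interior_open)
      from front[OF this] have "\<forall>\<^sub>F w in at z. \<not> (w \<in> D \<and> e \<le> u w)"
        unfolding eventually_at_filter by (auto elim!: eventually_mono)
      with z show ?thesis
        unfolding islimpt_iff_eventually by auto
    qed
  qed
  ultimately show ?thesis by (simp add: compact_eq_bounded_closed)
qed

text \<open>
  If \<open>u\<close> were positive somewhere, adding a small multiple of \<open>|z|\<^sup>2\<close> would give a function with positive
  Laplacian that still attains an interior maximum over a compact superlevel set. There the second
  derivatives in the real and in the imaginary direction are nonpositive, a contradiction. The boundary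
  conditions cover unbounded \<open>D\<close> by treating infinity like a frontier point.
\<close>

lemma harmonic_maximum_principle:
  assumes u: "harmonic_on u D"
    and front: "\<And>\<zeta> e. \<zeta> \<in> frontier D \<Longrightarrow> e > 0 \<Longrightarrow> \<forall>\<^sub>F z in at \<zeta> within D. u z < e"
    and inf: "\<And>e. e > 0 \<Longrightarrow> \<forall>\<^sub>F z in inf at_infinity (principal D). u z < e"
    and z: "z \<in> D"
  shows "u z \<le> 0"
proof (rule ccontr)
  assume "\<not> u z \<le> 0"
  define e where "e = u z / 2"
  define S where "S = {z \<in> D. e \<le> u z}"
  have e: "e > 0" using \<open>\<not> u z \<le> 0\<close> by (simp add: e_def)
  from u obtain ux uy uxx uxy uyx uyy where D: "open D" and
    du: "\<And>z. z \<in> D \<Longrightarrow> (u has_derivative (\<lambda>v. Re v * ux z + Im v * uy z)) (at z)"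
      "\<And>z. z \<in> D \<Longrightarrow> (ux has_derivative (\<lambda>v. Re v * uxx z + Im v * uxy z)) (at z)"
      "\<And>z. z \<in> D \<Longrightarrow> (uy has_derivative (\<lambda>v. Re v * uyx z + Im v * uyy z)) (at z)"
      "\<And>z. z \<in> D \<Longrightarrow> uxx z + uyy z = 0"
    unfolding harmonic_on_def by blast
  have cont: "continuous_on D u" using u by (rule harmonic_on_imp_continuous_on)
  have "compact S"
    unfolding S_def using superlevel_set_compact[OF cont front inf D] e by auto
  have "z \<in> S" using z e by (simp add: S_def e_def)
  obtain R where R: "R > 0" "\<And>w. w \<in> S \<Longrightarrow> norm w < R"
    using compact_imp_bounded[OF \<open>compact S\<close>] bounded_pos_less by blast
  \<comment> \<open>With this factor \<open>k |z|\<^sup>2\<close> stays below \<open>e\<close> on \<open>S\<close>, so a maximum of \<open>w\<close> lies where \<open>u > e\<close>.\<close>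
  define k where "k = e / (2 * R\<^sup>2)"
  have k: "k > 0" "k * R\<^sup>2 < e" using e R(1) by (auto simp: k_def)
  \<comment> \<open>The inner product \<open>z \<bullet> z\<close> is \<open>|z|\<^sup>2\<close>, whose Laplacian is \<open>4\<close>.\<close>
  define w where "w = (\<lambda>z. u z + k * (z \<bullet> z))"
  have "continuous_on S w"
    unfolding w_def using cont continuous_on_subset[of D u S]
    by (auto intro!: continuous_intros simp: S_def)
  then obtain x where x: "x \<in> S" "\<And>y. y \<in> S \<Longrightarrow> w y \<le> w x"
    using continuous_attains_sup[OF \<open>compact S\<close>] \<open>z \<in> S\<close> by blast
  have xD: "x \<in> D" using x(1) by (simp add: S_def)
  have small: "k * (x \<bullet> x) < e"
  proof -
    have "x \<bullet> x \<le> R\<^sup>2"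
      using R(2)[OF x(1)] by (simp add: power2_norm_eq_inner[symmetric] power_mono)
    then have "k * (x \<bullet> x) \<le> k * R\<^sup>2" using k(1) by simp
    with k(2) show ?thesis by simp
  qed
  have "w z \<le> w x" using x(2) \<open>z \<in> S\<close> by blast
  moreover have "k * (z \<bullet> z) \<ge> 0" using k(1) by simp
  ultimately have "e < u x" using small by (simp add: w_def e_def)
  moreover have "(u \<longlongrightarrow> u x) (nhds x)"
    using cont D xD by (simp add: continuous_on_eq_continuous_at isCont_def tendsto_at_iff_tendsto_nhds)
  ultimately have "\<forall>\<^sub>F y in nhds x. e < u y"
    by (rule order_tendstoD(1)[rotated])
  moreover have "\<forall>\<^sub>F y in nhds x. y \<in> D" using D xD by (simp add: eventually_nhds_in_open)
  ultimately have "\<forall>\<^sub>F y in nhds x. y \<in> S"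
    by eventually_elim (simp add: S_def)
  then obtain d where d: "d > 0" "\<And>y. dist y x < d \<Longrightarrow> y \<in> S"
    by (auto simp: eventually_nhds_metric)
  have second: "Re v * (Re v * uxx x + Im v * uxy x) + Im v * (Re v * uyx x + Im v * uyy x)
                  + 2 * k * (v \<bullet> v) \<le> 0" if v: "norm v = 1" for v
  proof (rule second_derivative_at_max_nonpos[OF d(1)])
    fix t :: real assume "\<bar>t\<bar> < d"
    then have t: "x + t *\<^sub>R v \<in> S" using d(2) v by (simp add: dist_norm)
    show "w (x + t *\<^sub>R v) \<le> w (x + 0 *\<^sub>R v)" using x(2)[OF t] by simp
    have tD: "x + t *\<^sub>R v \<in> D" using t by (simp add: S_def)
    have "((\<lambda>t. u (x + t *\<^sub>R v)) has_real_derivative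
             Re v * ux (x + t *\<^sub>R v) + Im v * uy (x + t *\<^sub>R v)) (at t)"
      by (rule has_real_derivative_along_line[OF du(1)[OF tD]])
    moreover have "((\<lambda>t. k * ((x + t *\<^sub>R v) \<bullet> (x + t *\<^sub>R v))) has_real_derivative
             2 * k * ((x + t *\<^sub>R v) \<bullet> v)) (at t)"
    proof -
      have "(\<lambda>t. k * ((x + t *\<^sub>R v) \<bullet> (x + t *\<^sub>R v)))
              = (\<lambda>t. k * (x \<bullet> x) + 2 * k * t * (x \<bullet> v) + k * (t * t) * (v \<bullet> v))"
        by (simp add: fun_eq_iff inner_add inner_commute[of v x] algebra_simps)
      moreover have "((\<lambda>t. k * (x \<bullet> x) + 2 * k * t * (x \<bullet> v) + k * (t * t) * (v \<bullet> v)) has_real_derivative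
             2 * k * (x \<bullet> v) + k * (2 * t) * (v \<bullet> v)) (at t)"
        by (auto intro!: derivative_eq_intros)
      moreover have "2 * k * ((x + t *\<^sub>R v) \<bullet> v) = 2 * k * (x \<bullet> v) + k * (2 * t) * (v \<bullet> v)"
        by (simp add: inner_add algebra_simps)
      ultimately show ?thesis by simp
    qed
    ultimately show "((\<lambda>t. w (x + t *\<^sub>R v)) has_real_derivative
         Re v * ux (x + t *\<^sub>R v) + Im v * uy (x + t *\<^sub>R v) + 2 * k * ((x + t *\<^sub>R v) \<bullet> v)) (at t)"
      unfolding w_def by (rule DERIV_add)
  next
    have x0: "x + 0 *\<^sub>R v \<in> D" using xD by simp
    have dx: "((\<lambda>t. ux (x + t *\<^sub>R v)) has_real_derivative Re v * uxx x + Im v * uxy x) (at 0)"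
     and dy: "((\<lambda>t. uy (x + t *\<^sub>R v)) has_real_derivative Re v * uyx x + Im v * uyy x) (at 0)"
      using has_real_derivative_along_line[OF du(2)[OF x0]]
            has_real_derivative_along_line[OF du(3)[OF x0]] by simp_all
    have eq: "(\<lambda>t. 2 * k * ((x + t *\<^sub>R v) \<bullet> v)) = (\<lambda>t. 2 * k * (x \<bullet> v) + (2 * k * (v \<bullet> v)) * t)"
      by (simp add: fun_eq_iff inner_add algebra_simps)
    have dq: "((\<lambda>t. 2 * k * ((x + t *\<^sub>R v) \<bullet> v)) has_real_derivative 2 * k * (v \<bullet> v)) (at 0)"
      unfolding eq by (auto intro!: derivative_eq_intros)
    show "((\<lambda>t. Re v * ux (x + t *\<^sub>R v) + Im v * uy (x + t *\<^sub>R v) + 2 * k * ((x + t *\<^sub>R v) \<bullet> v))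
       has_real_derivative Re v * (Re v * uxx x + Im v * uxy x) + Im v * (Re v * uyx x + Im v * uyy x)
                  + 2 * k * (v \<bullet> v)) (at 0)"
      by (rule DERIV_add[OF DERIV_add[OF DERIV_cmult[OF dx] DERIV_cmult[OF dy]] dq])
  qed
  have "uxx x + 2 * k \<le> 0" using second[of 1] by simp
  moreover have "uyy x + 2 * k \<le> 0" using second[of \<i>] by simp
  ultimately show False
    using du(4)[OF xD] k(1) by linarith
qed

text \<open>
  The functions \<open>exp \<circ> F n\<close> are locally bounded, so Montel's theorem yields a subsequence with a holomorphic
  limit \<open>H\<close>. Since \<open>|H| = exp g\<close> has no zero, \<open>H\<close> has a holomorphic logarithm on the ball, and \<open>g\<close> is the
  real part of it. Passing to exponentials avoids any normalisation of the imaginary parts of \<open>F n\<close>.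
\<close>

lemma harmonic_on_uniform_limit_Re:
  assumes F: "\<And>n. F n holomorphic_on ball z0 d"
    and lim: "uniform_limit (ball z0 d) (\<lambda>n z. Re (F n z)) g sequentially"
  shows "harmonic_on g (ball z0 d)"
proof -
  let ?B = "ball z0 d"
  have "\<forall>\<^sub>F n in sequentially. \<forall>z\<in>?B. dist (Re (F n z)) (g z) < 1"
    using uniform_limitD[OF lim, of 1] by simp
  then obtain N where N: "\<And>n z. n \<ge> N \<Longrightarrow> z \<in> ?B \<Longrightarrow> dist (Re (F n z)) (g z) < 1"
    unfolding eventually_sequentially by blast
  have "continuous_on ?B g"
  proof (rule uniform_limit_theorem[OF _ lim])
    show "\<forall>\<^sub>F n in sequentially. continuous_on ?B (\<lambda>z. Re (F n z))"
      using F by (intro always_eventually allI continuous_intros holomorphic_on_imp_continuous_on)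
  qed simp
  define E where "E = (\<lambda>n z. exp (F (n + N) z))"
  have bdd: "\<exists>M. \<forall>h\<in>range E. \<forall>z\<in>K. norm (h z) \<le> M" if "compact K" "K \<subseteq> ?B" for K
  proof -
    have "bounded (g ` K)"
      using \<open>continuous_on ?B g\<close> that by (meson compact_continuous_image compact_imp_bounded continuous_on_subset)
    then obtain M where M: "\<And>z. z \<in> K \<Longrightarrow> \<bar>g z\<bar> \<le> M"
      unfolding bounded_iff by auto
    have "norm (E n z) \<le> exp (M + 1)" if "z \<in> K" for n z
    proof -
      have "Re (F (n + N) z) \<le> M + 1"
        using N[of "n + N" z] M[OF that] that \<open>K \<subseteq> ?B\<close> by (auto simp: dist_real_def subset_iff)
      then show ?thesis by (simp add: E_def)
    qed
    then show ?thesis by blast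
  qed
  have hol: "h holomorphic_on ?B" if "h \<in> range E" for h
    using that F unfolding E_def by (auto intro!: holomorphic_intros)
  obtain H r where H: "H holomorphic_on ?B" and r: "strict_mono (r :: nat \<Rightarrow> nat)"
      and ptw: "\<And>z. z \<in> ?B \<Longrightarrow> ((\<lambda>n. E (r n) z) \<longlonglongrightarrow> H z)"
    using Montel[OF open_ball hol bdd order_refl] by metis
  have norm_H: "norm (H z) = exp (g z)" if z: "z \<in> ?B" for z
  proof -
    have "(\<lambda>n. Re (F n z)) \<longlonglongrightarrow> g z"
      using tendsto_uniform_limitI[OF lim z] .
    then have "(\<lambda>n. exp (Re (F (n + N) z))) \<longlonglongrightarrow> exp (g z)"
      by (intro tendsto_exp LIMSEQ_ignore_initial_segment)
    then have "(\<lambda>n. norm (E n z)) \<longlonglongrightarrow> exp (g z)"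
      by (simp add: E_def)
    then have "(\<lambda>n. norm (E (r n) z)) \<longlonglongrightarrow> exp (g z)"
      using LIMSEQ_subseq_LIMSEQ[OF _ r] unfolding o_def by fast
    with tendsto_norm[OF ptw[OF z]] show ?thesis
      using LIMSEQ_unique by blast
  qed
  have "H z \<noteq> 0" if "z \<in> ?B" for z
    using norm_H[OF that] by auto
  then obtain L where L: "L holomorphic_on ?B" "\<And>z. z \<in> ?B \<Longrightarrow> H z = exp (L z)"
    using contractible_imp_holomorphic_log[OF H convex_imp_contractible[OF convex_ball]] by metis
  have "g z = Re (L z)" if "z \<in> ?B" for z
    using norm_H[OF that] L(2)[OF that] by simp
  then show ?thesis
    using harmonic_on_cong[OF harmonic_on_Re[OF L(1) open_ball]] by blast
qed

section \<open>Green functions with pole at infinity\<close>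

lemma filterlim_ln_norm_at_top: "filterlim (\<lambda>z::complex. ln (norm z)) at_top at_infinity"
  using filterlim_compose[OF ln_at_top filterlim_norm_at_top] .

text \<open>
  The difference of two Green functions is bounded at infinity but has no evident sign there. The
  combination \<open>(1 - e) g\<^sub>1 - g\<^sub>2\<close> tends to minus infinity, because the logarithmic poles of \<open>g\<^sub>1\<close> and
  \<open>g\<^sub>2\<close> are equal, so the maximum principle makes it nonpositive for every \<open>e > 0\<close>.
\<close>

lemma is_green_function_le:
  assumes g1: "is_green_function D g1" and g2: "is_green_function D g2" and z: "z \<in> D"
  shows "g1 z \<le> g2 z"
proof (rule ccontr)
  assume less: "\<not> g1 z \<le> g2 z"
  have pos: "g1 z > 0" using g1 z by (simp add: is_green_function_def)
  \<comment> \<open>The combination would be \<open>(g1 z - g2 z) / 2 > 0\<close> at \<open>z\<close> for this \<open>e\<close>.\<close>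
  define e where "e = (g1 z - g2 z) / (2 * g1 z)"
  have e: "e > 0" "e * g1 z = (g1 z - g2 z) / 2" using less pos by (auto simp: e_def)
  let ?F = "inf at_infinity (principal D)"
  have "(1 - e) * g1 z + (- 1) * g2 z \<le> 0"
  proof (rule harmonic_maximum_principle[where u = "\<lambda>z. (1 - e) * g1 z + (- 1) * g2 z", OF _ _ _ z])
    show "harmonic_on (\<lambda>z. (1 - e) * g1 z + (- 1) * g2 z) D"
      using g1 g2 by (intro harmonic_on_lincomb) (auto simp: is_green_function_def)
  next
    fix \<zeta> and t :: real assume \<zeta>: "\<zeta> \<in> frontier D" and t: "t > 0"
    have "((\<lambda>z. (1 - e) * g1 z + (- 1) * g2 z) \<longlongrightarrow> (1 - e) * 0 + (- 1) * 0) (at \<zeta> within D)"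
      using g1 g2 \<zeta> by (intro tendsto_intros) (auto simp: is_green_function_def)
    then show "\<forall>\<^sub>F z in at \<zeta> within D. (1 - e) * g1 z + (- 1) * g2 z < t"
      using t by (intro order_tendstoD(2)[where a = t]) auto
  next
    fix t :: real assume t: "t > 0"
    obtain c1 where c1: "((\<lambda>z. g1 z - ln (norm z)) \<longlongrightarrow> c1) ?F"
      using g1 by (auto simp: is_green_function_def)
    obtain c2 where c2: "((\<lambda>z. g2 z - ln (norm z)) \<longlongrightarrow> c2) ?F"
      using g2 by (auto simp: is_green_function_def)
    have "((\<lambda>z. (1 - e) * (g1 z - ln (norm z)) - (g2 z - ln (norm z))) \<longlongrightarrow> (1 - e) * c1 - c2) ?F"
      by (intro tendsto_intros c1 c2)
    then have "\<forall>\<^sub>F z in ?F. (1 - e) * (g1 z - ln (norm z)) - (g2 z - ln (norm z)) < (1 - e) * c1 - c2 + 1"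
      by (rule order_tendstoD) simp
    moreover have "\<forall>\<^sub>F z in ?F. ln (norm z) \<ge> ((1 - e) * c1 - c2 + 1) / e"
      using filterlim_ln_norm_at_top unfolding filterlim_at_top
      by (blast intro: filter_leD[OF inf_le1])
    ultimately show "\<forall>\<^sub>F z in ?F. (1 - e) * g1 z + (- 1) * g2 z < t"
    proof eventually_elim
      case (elim z)
      have "(1 - e) * c1 - c2 + 1 \<le> e * ln (norm z)"
        using elim(2) e(1) by (simp add: field_simps)
      moreover have "(1 - e) * (g1 z - ln (norm z)) - (g2 z - ln (norm z))
           = (1 - e) * g1 z + (- 1) * g2 z + e * ln (norm z)"
        by (simp add: algebra_simps)
      ultimately show ?case using elim(1) t by linarith
    qed
  qed
  with e(2) less show False by (simp add: algebra_simps)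
qed

lemma is_green_function_cong:
  assumes "is_green_function D g" "\<And>z. z \<in> D \<Longrightarrow> f z = g z"
  shows "is_green_function D f"
proof -
  from assms(1) obtain c where D: "harmonic_on g D" "\<And>z. z \<in> D \<Longrightarrow> g z > 0"
      "\<And>\<zeta>. \<zeta> \<in> frontier D \<Longrightarrow> (g \<longlongrightarrow> 0) (at \<zeta> within D)"
      "((\<lambda>z. g z - ln (norm z)) \<longlongrightarrow> c) (inf at_infinity (principal D))"
    unfolding is_green_function_def by blast
  have "(f \<longlongrightarrow> 0) (at \<zeta> within D)" if "\<zeta> \<in> frontier D" for \<zeta>
    using D(3)[OF that]
    by (rule Lim_transform_eventually) (simp add: eventually_at_filter assms(2))
  moreover have "((\<lambda>z. f z - ln (norm z)) \<longlongrightarrow> c) (inf at_infinity (principal D))"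
    using D(4) by (rule Lim_transform_eventually) (simp add: eventually_inf_principal assms(2))
  ultimately show ?thesis
    unfolding is_green_function_def
    using harmonic_on_cong[OF D(1)] D(2) assms(2) by auto
qed

lemma green_unique:
  assumes "is_green_function (outside K) g" "\<And>z. z \<in> poly_hull K \<Longrightarrow> g z = 0"
  shows "green K = g"
  unfolding green_def
proof (rule the_equality)
  fix f assume f: "is_green_function (outside K) f \<and> (\<forall>z\<in>poly_hull K. f z = 0)"
  show "f = g"
  proof
    fix z show "f z = g z"
      using f assms is_green_function_le[of "outside K" f g z] is_green_function_le[of "outside K" g f z]
      by (cases "z \<in> outside K") (auto simp: poly_hull_def)
  qed
qed (use assms in blast)

lemma inf_at_infinity_cobounded:
  fixes D :: "complex set"
  assumes "bounded (- D)"
  shows "inf at_infinity (principal D) = at_infinity"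
proof (rule inf_absorb1)
  obtain R where R: "- D \<subseteq> ball 0 R"
    using bounded_subset_ballD[OF assms] by blast
  have "z \<in> D" if "R \<le> norm z" for z
  proof (rule ccontr)
    assume "z \<notin> D"
    with R have "z \<in> ball 0 R" by blast
    with that show False by simp
  qed
  then have "\<forall>\<^sub>F z in at_infinity. z \<in> D"
    unfolding eventually_at_infinity by blast
  then show "at_infinity \<le> principal D"
    by (simp add: le_principal)
qed

text \<open>
  The properties that characterise a Green function extended by zero, without mention of the compact
  set, which is the zero set of the function.
\<close>

definition green_like :: "(complex \<Rightarrow> real) \<Rightarrow> bool" where
  "green_like G \<longleftrightarrow> continuous_on UNIV G \<and> (\<forall>z. 0 \<le> G z) \<and> harmonic_on G {z. G z > 0} \<and>
     (\<exists>c. ((\<lambda>z. G z - ln (norm z)) \<longlongrightarrow> c) at_infinity)"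

text \<open>
  The point is that the complement of the zero set \<open>K\<close> has no bounded component. On the union
  \<open>inside K\<close> of these components \<open>G\<close> is harmonic and vanishes at the frontier, so \<open>G \<le> 0\<close> there by the
  maximum principle, while \<open>G > 0\<close> off \<open>K\<close>.
\<close>

lemma green_like_imp_green:
  assumes G: "green_like G"
  shows "regular_set {z. G z = 0}" "green {z. G z = 0} = G"
proof -
  define K where "K = {z. G z = 0}"
  have cont: "continuous_on UNIV G" and nonneg: "\<And>z. 0 \<le> G z" and harm: "harmonic_on G (- K)"
  proof -
    have "- K = {z. G z > 0}"
      using G by (auto simp: K_def green_like_def order.order_iff_strict)
    then show "continuous_on UNIV G" "\<And>z. 0 \<le> G z" "harmonic_on G (- K)"
      using G by (auto simp: green_like_def)
  qed
  obtain c where c: "((\<lambda>z. G z - ln (norm z)) \<longlongrightarrow> c) at_infinity"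
    using G by (auto simp: green_like_def)
  have lim: "(G \<longlongrightarrow> G z) (at z within S)" for z S
    using cont by (simp add: continuous_on_eq_continuous_at isCont_def Lim_at_imp_Lim_at_within)
  have "closed K"
  proof -
    have "K = G -` {0}" by (auto simp: K_def)
    then show ?thesis using continuous_closed_vimage[of "{0}" G] cont
      by (simp add: continuous_on_eq_continuous_at)
  qed
  have "bounded K"
  proof -
    have "\<forall>\<^sub>F z in at_infinity. c - 1 < G z - ln (norm z)"
      by (rule order_tendstoD[OF c]) simp
    moreover have "\<forall>\<^sub>F z::complex in at_infinity. ln (norm z) \<ge> 1 - c"
      using filterlim_ln_norm_at_top unfolding filterlim_at_top by blast
    ultimately have "\<forall>\<^sub>F z in at_infinity. G z > 0"
      by eventually_elim linarith
    then obtain R where R: "\<And>z. R \<le> norm z \<Longrightarrow> G z > 0"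
      unfolding eventually_at_infinity by blast
    then have "norm z \<le> R" if "z \<in> K" for z
      using that R[of z] by (cases "R \<le> norm z") (auto simp: K_def)
    then have "K \<subseteq> cball 0 R" by auto
    then show ?thesis using bounded_cball bounded_subset by blast
  qed
  have "inside K = {}"
  proof (rule ccontr)
    assume "inside K \<noteq> {}"
    then obtain z where z: "z \<in> inside K" by blast
    have "G z \<le> 0"
    proof (rule harmonic_maximum_principle[where u = G, OF _ _ _ z])
      show "harmonic_on G (inside K)"
        by (rule harmonic_on_subset[OF harm open_inside[OF \<open>closed K\<close>]])
          (use inside_no_overlap[of K] in blast)
    next
      fix \<zeta> and e :: real assume "\<zeta> \<in> frontier (inside K)" "e > 0"
      then have "G \<zeta> < e"
        using frontier_inside_subset[OF \<open>closed K\<close>] by (auto simp: K_def)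
      then show "\<forall>\<^sub>F z in at \<zeta> within inside K. G z < e"
        by (rule order_tendstoD(2)[OF lim])
    next
      fix e :: real
      obtain R where R: "\<And>z. z \<in> inside K \<Longrightarrow> norm z < R"
        using bounded_inside[OF \<open>bounded K\<close>] bounded_pos_less by blast
      show "\<forall>\<^sub>F z in inf at_infinity (principal (inside K)). G z < e"
        unfolding eventually_inf_principal eventually_at_infinity
        by (rule exI[of _ R]) (use R in force)
    qed
    then have "z \<in> K" using nonneg[of z] by (simp add: K_def)
    with z show False using inside_no_overlap[of K] by blast
  qed
  then have out: "outside K = - K"
    using inside_Un_outside[of K] by simp
  have green: "is_green_function (outside K) G"
    unfolding is_green_function_def out
  proof (intro conjI ballI harm)
    show "0 < G z" if "z \<in> - K" for z
      using that nonneg[of z] by (simp add: K_def)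
    show "(G \<longlongrightarrow> 0) (at \<zeta> within - K)" if "\<zeta> \<in> frontier (- K)" for \<zeta>
    proof -
      have "G \<zeta> = 0"
        using that \<open>closed K\<close> frontier_subset_closed[of K] by (auto simp: K_def)
      then show ?thesis using lim[of \<zeta>] by simp
    qed
    show "\<exists>c. ((\<lambda>z. G z - ln (norm z)) \<longlongrightarrow> c) (inf at_infinity (principal (- K)))"
      using c inf_at_infinity_cobounded[of "- K"] \<open>bounded K\<close> by auto
  qed
  then show "regular_set {z. G z = 0}"
    using \<open>closed K\<close> \<open>bounded K\<close> by (auto simp: regular_set_def K_def compact_eq_bounded_closed)
  show "green {z. G z = 0} = G"
    by (rule green_unique) (use green out in \<open>auto simp: K_def poly_hull_def\<close>)
qed

text \<open>
  The converse: continuity is the only property that the definition of a Green function does not state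
  outright. At a frontier point it combines the boundary limit from outside with the value zero on \<open>E\<close>.
\<close>

lemma green_like_green:
  assumes "regular_set E" "polynomially_convex E"
  shows "green_like (green E)" "{z. green E z = 0} = E"
proof -
  have out: "outside E = - E"
    using assms(2) by (auto simp: polynomially_convex_def poly_hull_def)
  obtain g0 where "is_green_function (outside E) g0" and "compact E"
    using assms(1) by (auto simp: regular_set_def)
  define g where "g = (\<lambda>z. if z \<in> E then 0 else g0 z)"
  have green: "is_green_function (- E) g"
    using is_green_function_cong[OF \<open>is_green_function (outside E) g0\<close>, of g] by (simp add: out g_def)
  then have eq: "green E = g"
    by (intro green_unique) (auto simp: out poly_hull_def g_def)
  have harm: "harmonic_on g (- E)" and pos: "\<And>z. z \<notin> E \<Longrightarrow> g z > 0"
    using green by (auto simp: is_green_function_def)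
  have zero: "g z = 0 \<longleftrightarrow> z \<in> E" for z
    using pos[of z] by (auto simp: g_def)
  have "isCont g z" for z
  proof (cases "z \<in> E")
    case False
    then show ?thesis
      using harmonic_on_imp_continuous_on[OF harm] \<open>compact E\<close>
      by (simp add: continuous_on_eq_continuous_at compact_imp_closed open_Compl)
  next
    case True
    have "(g \<longlongrightarrow> 0) (at z within - E)"
    proof (cases "z \<in> frontier (- E)")
      case True
      then show ?thesis using green by (simp add: is_green_function_def)
    next
      case False
      then have "at z within - E = bot"
        using \<open>z \<in> E\<close> \<open>compact E\<close>
        by (simp add: trivial_limit_within frontier_def closure_def interior_open compact_imp_closed open_Compl)
      then show ?thesis by simp
    qed
    moreover have "(g \<longlongrightarrow> 0) (at z within E)"
      by (rule tendsto_eventually) (simp add: eventually_at_filter g_def)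
    ultimately have "(g \<longlongrightarrow> 0) (at z within (- E \<union> E))"
      by (rule Lim_Un)
    then show ?thesis using True by (simp add: isCont_def g_def)
  qed
  then have cont: "continuous_on UNIV g"
    by (simp add: continuous_on_eq_continuous_at)
  have nonneg: "g z \<ge> 0" for z
    using pos[of z] zero[of z] by (cases "z \<in> E") auto
  have "{z. g z > 0} = - E"
    using pos zero by force
  with harm have harm': "harmonic_on g {z. g z > 0}" by simp
  have "\<exists>c. ((\<lambda>z. g z - ln (norm z)) \<longlongrightarrow> c) at_infinity"
    using green inf_at_infinity_cobounded[of "- E"] compact_imp_bounded[OF \<open>compact E\<close>]
    by (simp add: is_green_function_def)
  then show "green_like (green E)"
    using cont nonneg harm' unfolding eq green_like_def by blast
  show "{z. green E z = 0} = E"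
    using zero unfolding eq by blast
qed

section \<open>Logarithmic size of a polynomial with bounded zeros\<close>

text \<open>
  Free of a case distinction, this form makes continuity and monotonicity immediate.
\<close>

lemma log_plus_eq: "x \<ge> 0 \<Longrightarrow> log_plus x = ln (max 1 x)"
  by (auto simp: log_plus_def max_def)

lemma norm_linear_factors_bounds:
  fixes A :: "complex multiset"
  assumes "\<And>x. x \<in># A \<Longrightarrow> norm x \<le> r"
  shows "norm (\<Prod>x\<in>#A. w - x) \<le> (norm w + r) ^ size A"
    and "r \<le> norm w \<Longrightarrow> (norm w - r) ^ size A \<le> norm (\<Prod>x\<in>#A. w - x)"
proof -
  have "norm (\<Prod>x\<in>#A. w - x) \<le> (norm w + r) ^ size A \<and>
        (r \<le> norm w \<longrightarrow> (norm w - r) ^ size A \<le> norm (\<Prod>x\<in>#A. w - x))"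
    using assms
  proof (induction A)
    case empty
    show ?case by simp
  next
    case (add x A)
    have IH: "norm (\<Prod>x\<in>#A. w - x) \<le> (norm w + r) ^ size A"
        "r \<le> norm w \<Longrightarrow> (norm w - r) ^ size A \<le> norm (\<Prod>x\<in>#A. w - x)"
      using add by auto
    have x: "norm x \<le> r" using add.prems by simp
    have "norm (w - x) \<le> norm w + r" "norm w - r \<le> norm (w - x)"
      using x norm_triangle_ineq4[of w x] norm_triangle_ineq2[of w x] by linarith+
    then show ?case
      using IH x by (auto simp: norm_mult intro!: mult_mono order.trans[OF norm_ge_zero x])
  qed
  then show "norm (\<Prod>x\<in>#A. w - x) \<le> (norm w + r) ^ size A"
      "r \<le> norm w \<Longrightarrow> (norm w - r) ^ size A \<le> norm (\<Prod>x\<in>#A. w - x)" by auto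
qed

lemma norm_poly_bounds:
  fixes q :: "complex poly"
  assumes "q \<noteq> 0" "{z. poly q z = 0} \<subseteq> cball 0 r"
  shows norm_poly_le: "norm (poly q w) \<le> norm (lead_coeff q) * (norm w + r) ^ degree q"
    and norm_poly_ge: "r \<le> norm w \<Longrightarrow>
           norm (lead_coeff q) * (norm w - r) ^ degree q \<le> norm (poly q w)"
proof -
  obtain A where A: "size A = degree q" "q = smult (lead_coeff q) (\<Prod>x\<in>#A. [:- x, 1:])"
    using alg_closed_imp_factorization[OF assms(1)] by blast
  have ev: "poly q z = lead_coeff q * (\<Prod>x\<in>#A. z - x)" for z
    by (subst A(2)) (simp add: poly_prod_mset)
  have "norm x \<le> r" if "x \<in># A" for x
  proof -
    have "poly q x = 0" using that unfolding ev by auto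
    then show ?thesis using assms(2) by auto
  qed
  from norm_linear_factors_bounds[OF this, of A w]
  show "norm (poly q w) \<le> norm (lead_coeff q) * (norm w + r) ^ degree q"
    and "r \<le> norm w \<Longrightarrow> norm (lead_coeff q) * (norm w - r) ^ degree q \<le> norm (poly q w)"
    by (simp_all add: ev[of w] norm_mult A(1) mult_left_mono)
qed

text \<open>
  Recentred at \<open>z0\<close>, the polynomial keeps its leading coefficient. The reversed polynomial
  \<open>w\<^sup>m q(1 / w)\<close> with \<open>m = degree q\<close> takes this coefficient as its value at \<open>0\<close>, and the maximum modulus principle bounds it by
  the values on the circle of radius \<open>1 / d\<close>, hence by those of \<open>q\<close> on the circle of radius \<open>d\<close> around
  \<open>z0\<close>.
\<close>

lemma lead_coeff_le_bound_on_cball: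
  fixes q :: "complex poly"
  assumes d: "d > 0" and B: "\<And>z. z \<in> cball z0 d \<Longrightarrow> norm (poly q z) \<le> B"
  shows "norm (lead_coeff q) * d ^ degree q \<le> B"
proof -
  define s where "s = reflect_poly (pcompose q [:z0, 1:])"
  have deg: "degree (pcompose q [:z0, 1:]) = degree q" by (simp add: degree_pcompose)
  have lead: "lead_coeff (pcompose q [:z0, 1:]) = lead_coeff q"
    by (subst lead_coeff_comp) auto
  have "norm (poly s 0) \<le> B / d ^ degree q"
  proof (rule maximum_modulus_frontier[where f = "poly s" and S = "ball 0 (1 / d)"])
    fix w :: complex assume "w \<in> frontier (ball 0 (1 / d))"
    then have w: "norm w = 1 / d" using d by simp
    then have "w \<noteq> 0" using d by auto
    then have "poly s w = w ^ degree q * poly q (z0 + inverse w)"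
      by (simp add: s_def poly_reflect_poly_nz deg poly_pcompose)
    moreover have "norm (poly q (z0 + inverse w)) \<le> B"
      using w d by (intro B) (simp add: dist_norm norm_inverse)
    ultimately show "norm (poly s w) \<le> B / d ^ degree q"
      using d by (simp add: norm_mult norm_power w power_one_over divide_simps)
  qed (use d in \<open>auto intro!: holomorphic_intros continuous_intros\<close>)
  then show ?thesis
    using d by (simp add: s_def lead field_simps)
qed

lemma log_plus_mono: "0 \<le> x \<Longrightarrow> x \<le> y \<Longrightarrow> log_plus x \<le> log_plus y"
  by (simp add: log_plus_eq)

lemma log_plus_nonneg: "log_plus x \<ge> 0"
  by (simp add: log_plus_def)

lemma ln_le_log_plus: "x > 0 \<Longrightarrow> ln x \<le> log_plus x"
  by (simp add: log_plus_def)

text \<open>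
  For \<open>|w| > 1 + 2 r\<close> every factor \<open>|w - x|\<close> with a zero \<open>x\<close> lies between \<open>|w| / 2\<close> and \<open>2 |w|\<close>, so up to
  a factor of at most \<open>2\<^sup>d\<close> the polynomial has the size of its leading term. For smaller \<open>w\<close> the lower bound is
  trivial, because \<open>log\<^sup>+ |w| \<le> log (1 + 2 r)\<close>, and the upper bound \<open>|w| + r \<le> max 1 |w| (1 + 2 r)\<close>
  holds everywhere.
\<close>

lemma log_plus_norm_poly_approx:
  fixes q :: "complex poly"
  assumes deg: "degree q \<ge> 1" and r: "r > 0" and roots: "{z. poly q z = 0} \<subseteq> cball 0 r"
    and lead: "\<bar>ln (norm (lead_coeff q))\<bar> \<le> C * real (degree q)"
  shows "\<bar>1 / real (degree q) * log_plus (norm (poly q w)) - log_plus (norm w)\<bar> \<le> C + ln 2 + ln (1 + 2 * r)"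
proof -
  let ?d = "real (degree q)" and ?a = "norm (lead_coeff q)"
  have d: "?d > 0" and q: "q \<noteq> 0" using deg by auto
  have a: "?a > 0" using q by simp
  have C: "C \<ge> 0"
    using lead d order.trans[OF abs_ge_zero lead] by (simp add: zero_le_mult_iff)
  have ln2: "ln 2 \<ge> (0::real)" "ln (1 + 2 * r) \<ge> 0" using r by simp_all
  define m where "m = max 1 (norm w)"
  have m: "m \<ge> 1" "norm w \<le> m" by (auto simp: m_def)
  have lw: "log_plus (norm w) = ln m" by (simp add: m_def log_plus_eq)
  have "log_plus (norm (poly q w)) \<le> ?d * (C + ln m + ln (1 + 2 * r))"
  proof -
    have "norm w + r \<le> m * (1 + 2 * r)"
    proof -
      have "r \<le> m * (2 * r)" using mult_right_mono[OF m(1), of "2 * r"] r by simp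
      then show ?thesis using m(2) by (simp add: algebra_simps)
    qed
    then have "(norm w + r) ^ degree q \<le> (m * (1 + 2 * r)) ^ degree q"
      using r by (intro power_mono) auto
    then have "norm (poly q w) \<le> ?a * (m * (1 + 2 * r)) ^ degree q"
      using norm_poly_le[OF q roots, of w] mult_left_mono[of _ _ ?a] norm_ge_zero by (meson order.trans)
    also have "\<dots> = exp (ln ?a + ?d * (ln m + ln (1 + 2 * r)))"
    proof -
      have "exp (ln m + ln (1 + 2 * r)) = m * (1 + 2 * r)"
        unfolding exp_add using m r by simp
      then show ?thesis
        unfolding exp_add[of "ln ?a"] exp_of_nat_mult using a by simp
    qed
    also have "\<dots> \<le> exp (?d * (C + ln m + ln (1 + 2 * r)))"
      using lead by (simp add: algebra_simps)
    finally have "max 1 (norm (poly q w)) \<le> exp (?d * (C + ln m + ln (1 + 2 * r)))"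
      using d C m ln2 by simp
    then have "ln (max 1 (norm (poly q w))) \<le> ?d * (C + ln m + ln (1 + 2 * r))"
      by (subst ln_exp[symmetric], intro ln_mono) auto
    then show ?thesis by (simp add: log_plus_eq)
  qed
  then have upper: "1 / ?d * log_plus (norm (poly q w)) \<le> C + ln m + ln (1 + 2 * r)"
    using d by (simp add: field_simps)
  have lower: "ln m - (C + ln 2 + ln (1 + 2 * r)) \<le> 1 / ?d * log_plus (norm (poly q w))"
  proof (cases "norm w \<le> 1 + 2 * r")
    case True
    then have "ln m \<le> ln (1 + 2 * r)" using r by (simp add: m_def)
    moreover have "0 \<le> 1 / ?d * log_plus (norm (poly q w))" by (simp add: log_plus_nonneg)
    ultimately show ?thesis using C ln2 by linarith
  next
    case False
    then have w: "m = norm w" "r \<le> norm w" "norm w / 2 \<le> norm w - r" "norm w > 0"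
      using r by (auto simp: m_def)
    have "?d * (ln m - (C + ln 2)) \<le> ln ?a + ?d * ln (norm w / 2)"
      using lead w by (simp add: ln_div algebra_simps)
    also have "\<dots> = ln (?a * (norm w / 2) ^ degree q)"
      using a w by (simp add: ln_mult ln_realpow)
    also have "\<dots> \<le> ln (norm (poly q w))"
    proof (rule ln_mono)
      have "?a * (norm w / 2) ^ degree q \<le> ?a * (norm w - r) ^ degree q"
        using w by (intro mult_left_mono power_mono) auto
      with norm_poly_ge[OF q roots w(2)] show "?a * (norm w / 2) ^ degree q \<le> norm (poly q w)"
        by linarith
      show "0 < ?a * (norm w / 2) ^ degree q" using a w by simp
    qed
    also have "\<dots> \<le> log_plus (norm (poly q w))"
    proof (rule ln_le_log_plus)
      have "poly q w \<noteq> 0" using roots False r by (auto simp: subset_iff)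
      then show "0 < norm (poly q w)" by simp
    qed
    finally have "ln m - (C + ln 2) \<le> 1 / ?d * log_plus (norm (poly q w))"
      using d by (simp add: field_simps)
    then show ?thesis using ln2 by linarith
  qed
  from upper lower show ?thesis using lw ln2 by linarith
qed

lemma ln_norm_poly_asymptotics:
  fixes q :: "complex poly"
  assumes "degree q \<ge> 1"
  shows "((\<lambda>z. 1 / real (degree q) * ln (norm (poly q z)) - ln (norm z)) \<longlongrightarrow>
           1 / real (degree q) * ln (norm (lead_coeff q))) at_infinity"
proof -
  have "q \<noteq> 0" using assms by auto
  have "((\<lambda>z. 1 / real (degree q) * ln (norm (poly q z / z ^ degree q))) \<longlongrightarrow>
          1 / real (degree q) * ln (norm (lead_coeff q))) at_infinity"
    using \<open>q \<noteq> 0\<close> by (intro tendsto_intros poly_divide_tendsto_aux) auto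
  moreover have "\<forall>\<^sub>F z in at_infinity. 1 / real (degree q) * ln (norm (poly q z / z ^ degree q))
      = 1 / real (degree q) * ln (norm (poly q z)) - ln (norm z)"
  proof -
    have "\<forall>\<^sub>F z in at_infinity. norm (poly q z) \<ge> 1"
      using filterlim_compose[OF filterlim_norm_at_top filterlim_poly_at_infinity[of q]] assms
      unfolding filterlim_at_top by auto
    moreover have "\<forall>\<^sub>F z::complex in at_infinity. norm z \<ge> 1"
      unfolding eventually_at_infinity by blast
    ultimately show ?thesis
    proof eventually_elim
      case (elim z)
      then have "norm (poly q z) > 0" "norm z > 0" by linarith+
      then have "ln (norm (poly q z / z ^ degree q)) = ln (norm (poly q z)) - real (degree q) * ln (norm z)"
        by (simp add: norm_divide norm_power ln_div ln_realpow)
      then show ?case using assms by (simp add: field_simps)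
    qed
  qed
  ultimately show ?thesis
    by (rule Lim_transform_eventually)
qed

section \<open>Green functions of polynomial preimages\<close>

text \<open>
  \<open>G - log\<^sup>+\<close> is continuous on the plane and convergent at infinity.
\<close>

lemma green_like_log_plus:
  assumes "green_like G"
  obtains B where "\<And>w. \<bar>G w - log_plus (norm w)\<bar> \<le> B"
proof -
  from assms obtain c where cont: "continuous_on UNIV G"
    and c: "((\<lambda>z. G z - ln (norm z)) \<longlongrightarrow> c) at_infinity"
    by (auto simp: green_like_def)
  have "\<forall>\<^sub>F z in at_infinity. dist (G z - ln (norm z)) c < 1"
    using tendstoD[OF c, of 1] by simp
  then obtain R where R: "\<And>z. R \<le> norm z \<Longrightarrow> dist (G z - ln (norm z)) c < 1"
    unfolding eventually_at_infinity by blast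
  define f where "f = (\<lambda>w. G w - ln (max 1 (norm w)))"
  have f: "f w = G w - log_plus (norm w)" for w
    by (simp add: f_def log_plus_eq)
  have "continuous_on (cball 0 (max 1 R)) f"
    unfolding f_def using continuous_on_subset[OF cont subset_UNIV]
    by (auto intro!: continuous_intros)
  then have "bounded (f ` cball 0 (max 1 R))"
    by (intro compact_imp_bounded compact_continuous_image compact_cball)
  then obtain M where M: "\<And>w. norm w \<le> max 1 R \<Longrightarrow> \<bar>f w\<bar> \<le> M"
    unfolding bounded_iff by fastforce
  have "\<bar>f w\<bar> \<le> max M (\<bar>c\<bar> + 1)" for w
  proof (cases "norm w \<le> max 1 R")
    case True
    then show ?thesis using M[of w] by linarith
  next
    case False
    then have "f w = G w - ln (norm w)" by (simp add: f_def)
    moreover have "dist (G w - ln (norm w)) c < 1" using R[of w] False by simp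
    ultimately have "\<bar>f w - c\<bar> < 1" by (simp add: dist_real_def)
    then show ?thesis by linarith
  qed
  then show ?thesis using that unfolding f by blast
qed

lemma green_like_pullback:
  assumes G: "green_like G" and q: "degree q \<ge> 1"
  shows "green_like (\<lambda>z. 1 / real (degree q) * G (poly q z))"
proof -
  from G obtain c where cont: "continuous_on UNIV G" and nonneg: "\<And>z. 0 \<le> G z"
    and harm: "harmonic_on G {z. G z > 0}"
    and c: "((\<lambda>z. G z - ln (norm z)) \<longlongrightarrow> c) at_infinity"
    unfolding green_like_def by blast
  let ?d = "real (degree q)"
  have d: "?d > 0" using q by simp
  have pos: "{z. 1 / ?d * G (poly q z) > 0} = poly q -` {z. G z > 0}"
    using d q by (auto simp: zero_less_mult_iff zero_less_divide_iff)
  have op: "open (poly q -` {z. G z > 0})"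
    using harm by (intro open_vimage) (auto simp: harmonic_on_def intro!: continuous_intros)
  have "harmonic_on (\<lambda>z. G (poly q z)) (poly q -` {z. G z > 0})"
    by (rule harmonic_on_compose_holomorphic[OF harm _ op]) (auto intro!: holomorphic_intros)
  then have harm': "harmonic_on (\<lambda>z. 1 / ?d * G (poly q z)) (poly q -` {z. G z > 0})"
    using harmonic_on_lincomb[where b = 0 and a = "1 / ?d"] by fastforce
  have "((\<lambda>z. G (poly q z) - ln (norm (poly q z))) \<longlongrightarrow> c) at_infinity"
    using q by (intro filterlim_compose[OF c] filterlim_poly_at_infinity) simp
  then have "((\<lambda>z. 1 / ?d * (G (poly q z) - ln (norm (poly q z)))
                + (1 / ?d * ln (norm (poly q z)) - ln (norm z)))
       \<longlongrightarrow> 1 / ?d * c + 1 / ?d * ln (norm (lead_coeff q))) at_infinity"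
    by (intro tendsto_add tendsto_mult_left ln_norm_poly_asymptotics q)
  then have "((\<lambda>z. 1 / ?d * G (poly q z) - ln (norm z))
       \<longlongrightarrow> 1 / ?d * c + 1 / ?d * ln (norm (lead_coeff q))) at_infinity"
    by (rule Lim_transform_eventually) (simp add: algebra_simps)
  then have "\<exists>c. ((\<lambda>z. 1 / ?d * G (poly q z) - ln (norm z)) \<longlongrightarrow> c) at_infinity"
    by blast
  moreover have "continuous_on UNIV (\<lambda>z. 1 / ?d * G (poly q z))"
    by (intro continuous_intros continuous_on_compose2[OF cont]) auto
  moreover have "0 \<le> 1 / ?d * G (poly q z)" for z
    using nonneg by simp
  ultimately show ?thesis
    unfolding green_like_def pos using harm' by blast
qed

section \<open>The escape rate of a sequence of logarithmically tame polynomials\<close>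

lemma compos_eq_poly: "\<exists>q. compos p n = poly q \<and> degree q = (\<Prod>k=1..n. degree (p k))"
proof (induction n)
  case 0
  have "compos p 0 = poly [:0, 1:]" by (simp add: fun_eq_iff)
  then show ?case by (intro exI[of _ "[:0, 1:]"]) simp
next
  case (Suc n)
  then obtain q where q: "compos p n = poly q" "degree q = (\<Prod>k=1..n. degree (p k))" by blast
  show ?case
  proof (intro exI conjI)
    show "compos p (Suc n) = poly (pcompose (p (Suc n)) q)"
      by (simp add: q(1) fun_eq_iff poly_pcompose)
    show "degree (pcompose (p (Suc n)) q) = (\<Prod>k=1..Suc n. degree (p k))"
      by (simp add: q(2) degree_pcompose prod.cl_ivl_Suc)
  qed
qed

text \<open>
  The estimate that survives composition: each \<open>p n\<close> multiplies \<open>log\<^sup>+\<close> by its degree, up to an error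
  proportional to the degree. All further results on the sequence depend on this alone.
\<close>

locale log_tame =
  fixes p :: "nat \<Rightarrow> complex poly" and C :: real
  assumes degree_1: "degree (p 1) \<ge> 1"
    and degree_ge_2: "n \<ge> 2 \<Longrightarrow> degree (p n) \<ge> 2"
    and approx: "n \<ge> 1 \<Longrightarrow>
      \<bar>1 / real (degree (p n)) * log_plus (norm (poly (p n) w)) - log_plus (norm w)\<bar> \<le> C"
begin

text \<open>
  A real number, since it occurs only as a normalising factor; the empty product makes
  \<open>total_degree 0 = 1\<close>, the degree of the identity.
\<close>

definition total_degree :: "nat \<Rightarrow> real" where
  "total_degree n = real (\<Prod>k=1..n. degree (p k))"

definition scaled_log :: "nat \<Rightarrow> complex \<Rightarrow> real" where
  "scaled_log n z = 1 / total_degree n * log_plus (norm (compos p n z))"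

definition escape_rate :: "complex \<Rightarrow> real" where
  "escape_rate z = lim (\<lambda>n. scaled_log n z)"

lemma degree_pos: "n \<ge> 1 \<Longrightarrow> degree (p n) \<ge> 1"
  using degree_1 degree_ge_2[of n] by (cases "n = 1") auto

lemma total_degree_Suc: "total_degree (Suc n) = total_degree n * real (degree (p (Suc n)))"
  by (simp add: total_degree_def prod.cl_ivl_Suc)

lemma total_degree_pos: "total_degree n > 0"
  using degree_pos by (fastforce simp: total_degree_def intro!: prod_pos)

text \<open>
  The start must be \<open>n \<ge> 1\<close>, as the first polynomial of the sequence may have degree one.
\<close>

lemma total_degree_growth: "n \<ge> 1 \<Longrightarrow> 2 ^ k * total_degree n \<le> total_degree (n + k)"
proof (induction k)
  case (Suc k)
  have "2 ^ Suc k * total_degree n \<le> total_degree (n + k) * 2"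
    using Suc by simp
  also have "\<dots> \<le> total_degree (n + k) * real (degree (p (Suc (n + k))))"
    using degree_ge_2[of "Suc (n + k)"] Suc.prems total_degree_pos[of "n + k"] by (intro mult_left_mono) auto
  finally show ?case by (simp add: total_degree_Suc)
qed simp

lemma total_degree_at_top: "filterlim total_degree at_top sequentially"
proof (rule filterlim_at_top_mono[OF filterlim_real_sequentially])
  have "real n \<le> total_degree n" if "n \<ge> 1" for n
    using that
  proof (induction n rule: nat_induct_at_least)
    case base
    show ?case using degree_1 by (simp add: total_degree_def)
  next
    case (Suc n)
    have "real (Suc n) \<le> 2 * total_degree n" using Suc by simp
    also have "\<dots> \<le> total_degree (Suc n)" using total_degree_growth[OF Suc.hyps, of 1] by simp
    finally show ?case .
  qed
  then show "\<forall>\<^sub>F n in sequentially. real n \<le> total_degree n"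
    unfolding eventually_sequentially by blast
qed

lemma div_total_degree_tendsto_0: "(\<lambda>n. B / total_degree n) \<longlonglongrightarrow> 0"
  using real_tendsto_divide_at_top[OF tendsto_const total_degree_at_top] .

lemma C_nonneg: "C \<ge> 0"
  using order.trans[OF abs_ge_zero approx[of 1 0]] by simp

lemma scaled_log_nonneg: "scaled_log n z \<ge> 0"
  using total_degree_pos[of n] by (simp add: scaled_log_def log_plus_nonneg)

lemma scaled_log_step: "\<bar>scaled_log (Suc n) z - scaled_log n z\<bar> \<le> C / total_degree n"
proof -
  let ?w = "compos p n z" and ?d = "real (degree (p (Suc n)))"
  have "scaled_log (Suc n) z - scaled_log n z = 1 / total_degree n * (1 / ?d * log_plus (norm (poly (p (Suc n)) ?w)) - log_plus (norm ?w))"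
    by (simp add: scaled_log_def total_degree_Suc algebra_simps)
  also have "\<bar>\<dots>\<bar> \<le> 1 / total_degree n * C"
    unfolding abs_mult using total_degree_pos[of n] approx[of "Suc n" ?w] by (intro mult_mono) auto
  finally show ?thesis by simp
qed

text \<open>
  The steps from \<open>n\<close> onwards are bounded by a geometric series with ratio \<open>1 / 2\<close>; keeping its partial
  sum \<open>2 - 2 / 2\<^sup>k\<close> in the bound makes the induction on \<open>k\<close> work.
\<close>

lemma scaled_log_diff: 
  assumes "n \<ge> 1"
  shows "\<bar>scaled_log (n + k) z - scaled_log n z\<bar> \<le> 2 * C / total_degree n"
proof -
  have "\<bar>scaled_log (n + k) z - scaled_log n z\<bar> \<le> C / total_degree n * (2 - 2 / 2 ^ k)"
  proof (induction k)
    case (Suc k)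
    have "\<bar>scaled_log (n + Suc k) z - scaled_log (n + k) z\<bar> \<le> C / total_degree (n + k)"
      using scaled_log_step[of "n + k" z] by simp
    also have "\<dots> \<le> C / (2 ^ k * total_degree n)"
      using total_degree_growth[OF assms, of k] C_nonneg total_degree_pos by (intro divide_left_mono) auto
    finally have "\<bar>scaled_log (n + Suc k) z - scaled_log n z\<bar> \<le> C / (2 ^ k * total_degree n) + C / total_degree n * (2 - 2 / 2 ^ k)"
      using Suc by linarith
    also have "\<dots> = C / total_degree n * (1 / 2 ^ k + (2 - 2 / 2 ^ k))"
      by (simp only: distrib_left) simp
    also have "1 / 2 ^ k + (2 - 2 / 2 ^ k) = 2 - 2 / (2 ^ Suc k :: real)"
      by (simp add: field_simps)
    finally show ?case .
  qed simp
  also have "\<dots> \<le> C / total_degree n * 2"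
    using C_nonneg total_degree_pos[of n] by (intro mult_left_mono) auto
  finally show ?thesis by (simp add: mult.commute)
qed

lemma convergent_of_diff_bound:
  fixes s :: "nat \<Rightarrow> real"
  assumes "\<And>n k. n \<ge> 1 \<Longrightarrow> \<bar>s (n + k) - s n\<bar> \<le> B / total_degree n"
  shows "convergent s"
proof (rule Cauchy_convergent, rule CauchyI')
  fix e :: real assume "e > 0"
  then have "\<forall>\<^sub>F n in sequentially. B / total_degree n < e"
    by (rule order_tendstoD(2)[OF div_total_degree_tendsto_0])
  then have "\<forall>\<^sub>F n in sequentially. B / total_degree n < e \<and> n \<ge> 1"
    using eventually_ge_at_top[of 1] by eventually_elim simp
  then obtain M where M: "\<And>n. n \<ge> M \<Longrightarrow> B / total_degree n < e \<and> n \<ge> 1"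
    unfolding eventually_sequentially by blast
  have "dist (s m) (s n) < e" if "m \<ge> M" "m < n" for m n
    using assms[of m "n - m"] M[OF that(1)] that by (simp add: dist_real_def abs_minus_commute)
  then show "\<exists>M. \<forall>m\<ge>M. \<forall>n>m. dist (s m) (s n) < e" by blast
qed

lemma scaled_log_tendsto: "(\<lambda>n. scaled_log n z) \<longlonglongrightarrow> escape_rate z"
proof -
  have "convergent (\<lambda>n. scaled_log n z)"
    by (rule convergent_of_diff_bound) (rule scaled_log_diff)
  then show ?thesis
    by (simp add: escape_rate_def convergent_LIMSEQ_iff)
qed

lemma escape_rate_approx:
  assumes "n \<ge> 1"
  shows "\<bar>escape_rate z - scaled_log n z\<bar> \<le> 2 * C / total_degree n"
proof (rule LIMSEQ_le_const2)
  show "(\<lambda>k. \<bar>scaled_log (k + n) z - scaled_log n z\<bar>) \<longlonglongrightarrow> \<bar>escape_rate z - scaled_log n z\<bar>"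
    by (intro tendsto_intros LIMSEQ_ignore_initial_segment scaled_log_tendsto)
  show "\<exists>M. \<forall>k\<ge>M. \<bar>scaled_log (k + n) z - scaled_log n z\<bar> \<le> 2 * C / total_degree n"
    using scaled_log_diff[OF assms] by (simp add: add.commute)
qed

lemma uniform_limit_of_bound:
  assumes "\<And>n z. n \<ge> 1 \<Longrightarrow> \<bar>f n z - escape_rate z\<bar> \<le> B / total_degree n"
  shows "uniform_limit UNIV f escape_rate sequentially"
proof (rule uniform_limitI)
  fix e :: real assume "e > 0"
  then have "\<forall>\<^sub>F n in sequentially. B / total_degree n < e"
    by (rule order_tendstoD(2)[OF div_total_degree_tendsto_0])
  then show "\<forall>\<^sub>F n in sequentially. \<forall>z\<in>UNIV. dist (f n z) (escape_rate z) < e"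
    using eventually_ge_at_top[of 1]
  proof eventually_elim
    case (elim n)
    show ?case
    proof
      fix z show "dist (f n z) (escape_rate z) < e"
        using assms[OF elim(2), of z] elim(1) by (simp add: dist_real_def)
    qed
  qed
qed

lemma scaled_log_uniform_limit: "uniform_limit UNIV scaled_log escape_rate sequentially"
  by (rule uniform_limit_of_bound) (subst abs_minus_commute, rule escape_rate_approx)

lemma escape_rate_nonneg: "0 \<le> escape_rate z"
  by (rule LIMSEQ_le_const[OF scaled_log_tendsto]) (simp add: scaled_log_nonneg)

text \<open>
  A bounded orbit makes \<open>scaled_log n z = O(1 / total_degree n)\<close>. Conversely, if the escape rate is zero,
  the error bound alone says \<open>log\<^sup>+ |P\<^sub>n(z)| \<le> 2 C\<close> for the compositions \<open>P\<^sub>n\<close>.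
\<close>

lemma filled_julia_eq: "filled_julia p = {z. escape_rate z = 0}"
proof (intro set_eqI iffI)
  fix z assume "z \<in> filled_julia p"
  then obtain B where B: "\<And>n. n \<ge> 1 \<Longrightarrow> norm (compos p n z) \<le> B"
    unfolding filled_julia_def bounded_iff by auto
  have "escape_rate z \<le> 0"
  proof (rule LIMSEQ_le[OF scaled_log_tendsto div_total_degree_tendsto_0])
    have "scaled_log n z \<le> log_plus B / total_degree n" if "n \<ge> 1" for n
      using log_plus_mono[OF norm_ge_zero B[OF that]] total_degree_pos[of n] by (simp add: scaled_log_def divide_right_mono)
    then show "\<exists>N. \<forall>n\<ge>N. scaled_log n z \<le> log_plus B / total_degree n" by blast
  qed
  then show "z \<in> {z. escape_rate z = 0}" using escape_rate_nonneg[of z] by simp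
next
  fix z assume "z \<in> {z. escape_rate z = 0}"
  then have z: "escape_rate z = 0" by simp
  have "norm (compos p n z) \<le> exp (2 * C)" if "n \<ge> 1" for n
  proof -
    have "scaled_log n z \<le> 2 * C / total_degree n" using escape_rate_approx[OF that, of z] z by simp
    then have "log_plus (norm (compos p n z)) \<le> 2 * C"
      using total_degree_pos[of n] by (simp add: scaled_log_def divide_le_cancel)
    then have "exp (ln (max 1 (norm (compos p n z)))) \<le> exp (2 * C)"
      by (simp only: log_plus_eq[OF norm_ge_zero] exp_le_cancel_iff)
    moreover have "exp (ln (max 1 (norm (compos p n z)))) = max 1 (norm (compos p n z))"
      by (rule exp_ln) simp
    ultimately show ?thesis by linarith
  qed
  then show "z \<in> filled_julia p"
    unfolding filled_julia_def bounded_iff by auto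
qed

lemma continuous_on_escape_rate: "continuous_on UNIV escape_rate"
proof (rule uniform_limit_theorem[OF _ scaled_log_uniform_limit])
  have "continuous_on UNIV (scaled_log n)" for n
  proof -
    obtain q where q: "compos p n = poly q" using compos_eq_poly by blast
    show ?thesis
      unfolding scaled_log_def log_plus_eq[OF norm_ge_zero] q
      using total_degree_pos[of n] by (auto intro!: continuous_intros)
  qed
  then show "\<forall>\<^sub>F n in sequentially. continuous_on UNIV (scaled_log n)" by simp
qed simp

text \<open>
  Near a point with positive escape rate, uniform convergence makes \<open>|P\<^sub>n| > 1\<close> on a fixed ball for large
  \<open>n\<close>. There \<open>log\<^sup>+ |P\<^sub>n|\<close> is \<open>log |P\<^sub>n|\<close>, the real part of a branch of the logarithm of \<open>P\<^sub>n\<close>.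
\<close>

lemma harmonic_on_escape_rate: "harmonic_on escape_rate {z. escape_rate z > 0}"
proof (rule harmonic_on_local)
  show op: "open {z. escape_rate z > 0}"
    using continuous_on_escape_rate by (intro open_Collect_less) auto
  fix z0 assume "z0 \<in> {z. escape_rate z > 0}"
  then have e: "escape_rate z0 / 2 > 0" by simp
  have "open {z. escape_rate z > escape_rate z0 / 2}"
    using continuous_on_escape_rate by (intro open_Collect_less) auto
  moreover have "z0 \<in> {z. escape_rate z > escape_rate z0 / 2}" using e by simp
  ultimately obtain d where d: "d > 0" "ball z0 d \<subseteq> {z. escape_rate z > escape_rate z0 / 2}"
    using openE by blast
  have "\<forall>\<^sub>F n in sequentially. \<forall>z\<in>UNIV. dist (scaled_log n z) (escape_rate z) < escape_rate z0 / 2"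
    by (rule uniform_limitD[OF scaled_log_uniform_limit e])
  then obtain M where M: "\<And>n z. n \<ge> M \<Longrightarrow> dist (scaled_log n z) (escape_rate z) < escape_rate z0 / 2"
    unfolding eventually_sequentially by auto
  have "\<exists>F. F holomorphic_on ball z0 d \<and> (\<forall>z\<in>ball z0 d. Re (F z) = scaled_log (n + M) z)" for n
  proof -
    obtain q where q: "compos p (n + M) = poly q" using compos_eq_poly by blast
    have big: "norm (poly q z) > 1" if z: "z \<in> ball z0 d" for z
    proof (rule ccontr)
      assume "\<not> norm (poly q z) > 1"
      then have "scaled_log (n + M) z = 0" by (simp add: scaled_log_def q log_plus_eq)
      moreover have "escape_rate z > escape_rate z0 / 2" using z d(2) by blast
      ultimately show False using M[of "n + M" z] by (simp add: dist_real_def)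
    qed
    then have "poly q z \<noteq> 0" if "z \<in> ball z0 d" for z using that by force
    moreover have "poly q holomorphic_on ball z0 d"
      by (auto intro!: holomorphic_intros)
    ultimately obtain L where L: "L holomorphic_on ball z0 d" "\<And>z. z \<in> ball z0 d \<Longrightarrow> poly q z = exp (L z)"
      using contractible_imp_holomorphic_log[of "poly q" "ball z0 d"]
        convex_imp_contractible[OF convex_ball] by metis
    have "Re (L z / of_real (total_degree (n + M))) = scaled_log (n + M) z" if z: "z \<in> ball z0 d" for z
      using big[OF z] L(2)[OF z] by (simp add: scaled_log_def q log_plus_eq)
    moreover have "(\<lambda>z. L z / of_real (total_degree (n + M))) holomorphic_on ball z0 d"
      using L(1) total_degree_pos[of "n + M"] by (intro holomorphic_intros) auto
    ultimately show ?thesis by blast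
  qed
  then obtain F where F: "\<And>n. F n holomorphic_on ball z0 d"
      "\<And>n z. z \<in> ball z0 d \<Longrightarrow> Re (F n z) = scaled_log (n + M) z"
    by metis
  have "uniform_limit UNIV (\<lambda>n. scaled_log (n + M)) escape_rate sequentially"
    by (rule filterlim_compose[OF scaled_log_uniform_limit filterlim_add_const_nat_at_top])
  then have "uniform_limit (ball z0 d) (\<lambda>n. scaled_log (n + M)) escape_rate sequentially"
    by (rule uniform_limit_on_subset) simp
  then have "uniform_limit (ball z0 d) (\<lambda>n z. Re (F n z)) escape_rate sequentially"
    by (rule uniform_limit_cong'[THEN iffD1, rotated 2]) (simp_all add: F(2))
  with F(1) have "harmonic_on escape_rate (ball z0 d)"
    by (rule harmonic_on_uniform_limit_Re)
  then show "\<exists>U. z0 \<in> U \<and> harmonic_on escape_rate U"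
    using d(1) by (intro exI[of _ "ball z0 d"]) simp
qed

lemma scaled_log_asymptotics: 
  assumes "n \<ge> 1"
  shows "\<exists>c. ((\<lambda>z. scaled_log n z - ln (norm z)) \<longlongrightarrow> c) at_infinity"
proof -
  obtain q where q: "compos p n = poly q" "degree q = (\<Prod>k=1..n. degree (p k))"
    using compos_eq_poly by blast
  have total_degree_q: "total_degree n = real (degree q)" by (simp add: total_degree_def q(2))
  then have dq: "degree q \<ge> 1" using total_degree_pos[of n] by simp
  have "\<forall>\<^sub>F z in at_infinity. norm (poly q z) \<ge> 1"
    using filterlim_compose[OF filterlim_norm_at_top filterlim_poly_at_infinity[of q]] dq
    unfolding filterlim_at_top by auto
  then have "\<forall>\<^sub>F z in at_infinity. 1 / real (degree q) * ln (norm (poly q z)) - ln (norm z) = scaled_log n z - ln (norm z)"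
    by eventually_elim (simp add: scaled_log_def total_degree_q q(1) log_plus_eq max_def)
  with ln_norm_poly_asymptotics[OF dq] show ?thesis
    by (intro exI) (rule Lim_transform_eventually)
qed

text \<open>
  The limits \<open>c n\<close> of \<open>scaled_log n z - ln |z|\<close> at infinity inherit the Cauchy estimate of the functions, and
  uniform convergence allows the two limits to be interchanged.
\<close>

lemma escape_rate_asymptotics: "\<exists>c. ((\<lambda>z. escape_rate z - ln (norm z)) \<longlongrightarrow> c) at_infinity"
proof -
  obtain c where c: "\<And>n. n \<ge> 1 \<Longrightarrow> ((\<lambda>z. scaled_log n z - ln (norm z)) \<longlongrightarrow> c n) at_infinity"
    using scaled_log_asymptotics by metis
  have "\<bar>c (n + k) - c n\<bar> \<le> 2 * C / total_degree n" if n: "n \<ge> 1" for n k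
  proof (rule tendsto_upperbound)
    show "((\<lambda>z. \<bar>(scaled_log (n + k) z - ln (norm z)) - (scaled_log n z - ln (norm z))\<bar>) \<longlongrightarrow> \<bar>c (n + k) - c n\<bar>) at_infinity"
      using n by (intro tendsto_intros c) auto
    show "\<forall>\<^sub>F z in at_infinity. \<bar>(scaled_log (n + k) z - ln (norm z)) - (scaled_log n z - ln (norm z))\<bar> \<le> 2 * C / total_degree n"
      using scaled_log_diff[OF n] by simp
  qed (rule trivial_limit_at_infinity)
  then have "convergent c" by (rule convergent_of_diff_bound)
  then obtain l where l: "c \<longlonglongrightarrow> l" by (auto simp: convergent_def)
  have "((\<lambda>z. escape_rate z - ln (norm z)) \<longlongrightarrow> l) at_infinity"
  proof (rule swap_uniform_limit'[OF _ l])
    show "\<forall>\<^sub>F n in sequentially. ((\<lambda>z. scaled_log n z - ln (norm z)) \<longlongrightarrow> c n) at_infinity"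
      using eventually_ge_at_top[of 1] by eventually_elim (rule c)
    show "uniform_limit UNIV (\<lambda>n z. scaled_log n z - ln (norm z)) (\<lambda>z. escape_rate z - ln (norm z)) sequentially"
      by (intro uniform_limit_intros scaled_log_uniform_limit)
  qed auto
  then show ?thesis by blast
qed

lemma green_like_escape_rate: "green_like escape_rate"
  unfolding green_like_def
  by (intro conjI allI continuous_on_escape_rate escape_rate_nonneg harmonic_on_escape_rate escape_rate_asymptotics)

text \<open>
  The right-hand side satisfies \<open>green_like\<close> and vanishes exactly on the preimage of \<open>E\<close>. That the
  complement of the preimage is connected is a consequence contained in \<open>green_like_imp_green\<close>.
\<close>

lemma green_preimage:
  assumes "regular_set E" "polynomially_convex E"
  shows "green (compos p n -` E) = (\<lambda>z. 1 / total_degree n * green E (compos p n z))"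
proof -
  obtain q where q: "compos p n = poly q" "degree q = (\<Prod>k=1..n. degree (p k))"
    using compos_eq_poly by blast
  have total_degree_q: "total_degree n = real (degree q)" by (simp add: total_degree_def q(2))
  then have dq: "degree q \<ge> 1" using total_degree_pos[of n] by simp
  let ?G = "\<lambda>z. 1 / total_degree n * green E (compos p n z)"
  have "green_like ?G"
    unfolding total_degree_q q(1) by (rule green_like_pullback[OF green_like_green(1)[OF assms] dq])
  then have "green {z. ?G z = 0} = ?G"
    by (rule green_like_imp_green(2))
  moreover have "{z. ?G z = 0} = compos p n -` {z. green E z = 0}"
    using total_degree_pos[of n] by auto
  ultimately show ?thesis
    by (simp add: green_like_green(2)[OF assms])
qed

end

section \<open>Leading coefficients of a guided sequence\<close>

text \<open>
  The guiding function \<open>h\<close> tends to infinity, since \<open>\<alpha> \<ge> 0\<close>, so it is nonnegative at some \<open>z0\<close> outside the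
  disc of radius \<open>r\<close>. There the growth condition gives \<open>|p n z0| > 1\<close> for large \<open>n\<close>, whereas
  \<open>|p n z0|\<close> is at most \<open>|a| (|z0| + r)\<^sup>d\<close> with leading coefficient \<open>a\<close> and degree \<open>d\<close>.
\<close>

lemma guided_lead_coeff_lower_bound:
  assumes "guided p"
  obtains r M where "r > 0" "\<And>n. n \<ge> 1 \<Longrightarrow> {z. poly (p n) z = 0} \<subseteq> cball 0 r"
    "\<And>n. n \<ge> 1 \<Longrightarrow> - M * real (degree (p n)) \<le> ln (norm (lead_coeff (p n)))"
proof -
  define \<alpha> where "\<alpha> = real_of_ereal (limsup (\<lambda>n. ereal (1 / real (degree (p n)))))"
  from assms obtain r N and h :: "complex \<Rightarrow> real" where deg: "degree (p 1) \<ge> 1" "\<And>n. n \<ge> 2 \<Longrightarrow> degree (p n) \<ge> 2"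
    and r: "r > 0" and h: "filterlim (\<lambda>z. h z - \<alpha> * ln (norm z)) at_top at_infinity"
    and roots: "(\<Union>n\<in>{1..}. {z. poly (p n) z = 0}) \<subseteq> cball 0 r"
    and N: "N > (1::nat)" "\<And>n \<zeta>. n \<ge> N \<Longrightarrow> \<zeta> \<in> - cball 0 r \<Longrightarrow>
              1 / real (degree (p n)) * log_plus (norm (poly (p n) \<zeta>)) > h \<zeta>"
    unfolding guided_def Let_def \<alpha>_def by blast
  have roots': "{z. poly (p n) z = 0} \<subseteq> cball 0 r" if "n \<ge> 1" for n
    using roots that by auto
  have d: "degree (p n) \<ge> 1" if "n \<ge> 1" for n
    using deg(1) deg(2)[of n] that by (cases "n = 1") auto
  have "\<alpha> \<ge> 0"
    unfolding \<alpha>_def by (intro real_of_ereal_pos le_Limsup) auto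
  have "\<forall>\<^sub>F z in at_infinity. 0 \<le> h z - \<alpha> * ln (norm z)"
    using h unfolding filterlim_at_top by blast
  moreover have "\<forall>\<^sub>F z::complex in at_infinity. norm z \<ge> r + 1"
    unfolding eventually_at_infinity by blast
  moreover have "\<forall>\<^sub>F z::complex in at_infinity. norm z \<ge> 1"
    unfolding eventually_at_infinity by blast
  ultimately have "\<forall>\<^sub>F z in at_infinity. 0 \<le> h z \<and> r + 1 \<le> norm z"
  proof eventually_elim
    case (elim z)
    have "0 \<le> \<alpha> * ln (norm z)" using \<open>\<alpha> \<ge> 0\<close> elim(3) by simp
    with elim show ?case by linarith
  qed
  then obtain z0 where z0: "0 \<le> h z0" "r + 1 \<le> norm z0"
    using eventually_happens trivial_limit_at_infinity by blast
  define M0 where "M0 = ln (norm z0 + r)"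
  \<comment> \<open>The sum takes care of the finitely many polynomials before the index \<open>N\<close>.\<close>
  define M where "M = M0 + (\<Sum>k<N. \<bar>ln (norm (lead_coeff (p k)))\<bar>)"
  have M0: "M0 \<ge> 0" using z0(2) r by (simp add: M0_def)
  have "- M * real (degree (p n)) \<le> ln (norm (lead_coeff (p n)))" if n: "n \<ge> 1" for n
  proof (cases "n < N")
    case True
    let ?l = "ln (norm (lead_coeff (p n)))"
    have "\<bar>?l\<bar> \<le> (\<Sum>k<N. \<bar>ln (norm (lead_coeff (p k)))\<bar>)"
      using True by (intro member_le_sum) auto
    then have "\<bar>?l\<bar> \<le> M * 1" using M0 by (simp add: M_def)
    also have "\<dots> \<le> M * real (degree (p n))"
      using d[OF n] M0 by (intro mult_left_mono) (auto simp: M_def intro!: add_nonneg_nonneg sum_nonneg)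
    finally show ?thesis by linarith
  next
    case False
    let ?q = "p n"
    have q: "?q \<noteq> 0" using d[OF n] by auto
    have "0 < 1 / real (degree ?q) * log_plus (norm (poly ?q z0))"
      using N(2)[of n z0] False z0 by force
    then have "log_plus (norm (poly ?q z0)) \<noteq> 0" by auto
    then have "1 < norm (poly ?q z0)"
      by (rule contrapos_np) (simp add: log_plus_eq max_def)
    also have "\<dots> \<le> norm (lead_coeff ?q) * (norm z0 + r) ^ degree ?q"
      by (rule norm_poly_le[OF q roots'[OF n]])
    finally have "ln 1 \<le> ln (norm (lead_coeff ?q) * (norm z0 + r) ^ degree ?q)"
      by (intro ln_mono) auto
    also have "\<dots> = ln (norm (lead_coeff ?q)) + real (degree ?q) * M0"
    proof -
      have "norm z0 + r > 0" using z0(2) r by linarith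
      then show ?thesis using q by (simp add: ln_mult ln_realpow M0_def)
    qed
    finally have "- M0 * real (degree ?q) \<le> ln (norm (lead_coeff ?q))"
      by (simp add: mult.commute)
    moreover have "M0 * real (degree ?q) \<le> M * real (degree ?q)"
      by (intro mult_right_mono) (auto simp: M_def intro!: sum_nonneg)
    ultimately show ?thesis by linarith
  qed
  with r roots' show ?thesis by (rule that)
qed

text \<open>
  By Baire's theorem one of the closed sets \<open>S m\<close>, on which the bound is \<open>m\<close>, contains a disc. The bound
  \<open>exp (m d)\<close> for a polynomial of degree \<open>d\<close> on a disc of radius \<open>e\<close> yields \<open>exp (m d) / e\<^sup>d\<close> for its
  leading coefficient.
\<close>

lemma pointwise_bounded_lead_coeff_upper_bound:
  fixes p :: "nat \<Rightarrow> complex poly"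
  assumes "open D" "D \<noteq> {}"
    and bdd: "\<And>z. z \<in> D \<Longrightarrow>
           bdd_above ((\<lambda>n. 1 / real (degree (p n)) * log_plus (norm (poly (p n) z))) ` {1..})"
    and deg: "\<And>n. n \<ge> 1 \<Longrightarrow> degree (p n) \<ge> 1"
  obtains M where "\<And>n. n \<ge> 1 \<Longrightarrow> ln (norm (lead_coeff (p n))) \<le> M * real (degree (p n))"
proof -
  have nz: "p n \<noteq> 0" if "n \<ge> 1" for n
    using deg[OF that] by auto
  define S where "S = (\<lambda>m::nat. \<Inter>n\<in>{1..}. {z. norm (poly (p n) z) \<le> exp (real m * real (degree (p n)))})"
  have closed: "closed (S m)" for m
    unfolding S_def by (intro closed_INT ballI closed_Collect_le continuous_intros)
  have cover: "\<exists>m. z \<in> S m" if z: "z \<in> D" for z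
  proof -
    obtain B where B: "\<And>n. n \<ge> 1 \<Longrightarrow> 1 / real (degree (p n)) * log_plus (norm (poly (p n) z)) \<le> B"
      using bdd[OF z] unfolding bdd_above_def by auto
    obtain m where m: "B \<le> real m" using real_arch_simple by blast
    have "norm (poly (p n) z) \<le> exp (real m * real (degree (p n)))" if n: "n \<ge> 1" for n
    proof -
      have "1 / real (degree (p n)) * log_plus (norm (poly (p n) z)) \<le> real m"
        using B[OF n] m by linarith
      then have "ln (max 1 (norm (poly (p n) z))) \<le> real m * real (degree (p n))"
        using deg[OF n] by (simp add: log_plus_eq[OF norm_ge_zero] divide_le_eq)
      then have "exp (ln (max 1 (norm (poly (p n) z)))) \<le> exp (real m * real (degree (p n)))"
        by (simp only: exp_le_cancel_iff)
      moreover have "exp (ln (max 1 (norm (poly (p n) z)))) = max 1 (norm (poly (p n) z))"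
        by (rule exp_ln) simp
      ultimately show ?thesis by linarith
    qed
    then show ?thesis by (auto simp: S_def)
  qed
  have "\<exists>m. interior (S m) \<noteq> {}"
  proof (rule ccontr)
    assume "\<not> ?thesis"
    then have dense: "closure (- S m) = UNIV" for m
      by (simp add: closure_complement)
    have "UNIV \<subseteq> closure (\<Inter> (range (\<lambda>m. - S m)))"
      by (rule Baire) (use closed dense in \<open>auto simp: open_Compl\<close>)
    then have "D \<inter> \<Inter> (range (\<lambda>m. - S m)) \<noteq> {}"
      using assms(1,2) open_Int_closure_eq_empty[OF assms(1)] by (metis inf_top_right top.extremum_uniqueI)
    with cover show False by blast
  qed
  then obtain m z0 e where e: "e > 0" "cball z0 e \<subseteq> S m"
    using open_contains_cball[of "interior (S _)"] interior_subset by (metis all_not_in_conv open_interior order.trans)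
  have "ln (norm (lead_coeff (p n))) \<le> (real m - ln e) * real (degree (p n))" if n: "n \<ge> 1" for n
  proof -
    let ?d = "degree (p n)"
    have "norm (lead_coeff (p n)) * e ^ ?d \<le> exp (real m * real ?d)"
      by (rule lead_coeff_le_bound_on_cball[OF e(1)]) (use e(2) n in \<open>auto simp: S_def\<close>)
    then have "ln (norm (lead_coeff (p n)) * e ^ ?d) \<le> ln (exp (real m * real ?d))"
      using nz[OF n] e(1) by (intro ln_mono) auto
    then have "ln (norm (lead_coeff (p n))) + real ?d * ln e \<le> real m * real ?d"
      using nz[OF n] e(1) by (simp add: ln_mult ln_realpow)
    then show ?thesis by (simp add: algebra_simps)
  qed
  then show ?thesis by (rule that)
qed

lemma guided_log_tame:
  assumes "guided p" "open D" "D \<noteq> {}"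
    and bdd: "\<And>z. z \<in> D \<Longrightarrow>
           bdd_above ((\<lambda>n. 1 / real (degree (p n)) * log_plus (norm (poly (p n) z))) ` {1..})"
  obtains C where "log_tame p C"
proof -
  have deg: "degree (p 1) \<ge> 1" "\<And>n. n \<ge> 2 \<Longrightarrow> degree (p n) \<ge> 2"
    using assms(1) by (auto simp: guided_def)
  have d: "degree (p n) \<ge> 1" if "n \<ge> 1" for n
    using deg(1) deg(2)[of n] that by (cases "n = 1") auto
  obtain r M1 where r: "r > 0" and roots: "\<And>n. n \<ge> 1 \<Longrightarrow> {z. poly (p n) z = 0} \<subseteq> cball 0 r"
    and M1: "\<And>n. n \<ge> 1 \<Longrightarrow> - M1 * real (degree (p n)) \<le> ln (norm (lead_coeff (p n)))"
    using guided_lead_coeff_lower_bound[OF assms(1)] by blast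
  obtain M2 where M2: "\<And>n. n \<ge> 1 \<Longrightarrow> ln (norm (lead_coeff (p n))) \<le> M2 * real (degree (p n))"
    using pointwise_bounded_lead_coeff_upper_bound[OF assms(2,3) bdd d] by blast
  define M where "M = max M1 M2"
  have lead: "\<bar>ln (norm (lead_coeff (p n)))\<bar> \<le> M * real (degree (p n))" if n: "n \<ge> 1" for n
  proof -
    have "M1 * real (degree (p n)) \<le> M * real (degree (p n))" "M2 * real (degree (p n)) \<le> M * real (degree (p n))"
      by (auto intro!: mult_right_mono simp: M_def)
    with M1[OF n] M2[OF n] show ?thesis by linarith
  qed
  have "log_tame p (M + ln 2 + ln (1 + 2 * r))"
  proof
    show "\<bar>1 / real (degree (p n)) * log_plus (norm (poly (p n) w)) - log_plus (norm w)\<bar>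
            \<le> M + ln 2 + ln (1 + 2 * r)" if n: "n \<ge> 1" for n w
      by (rule log_plus_norm_poly_approx[OF d[OF n] r roots[OF n] lead[OF n]])
  qed (use deg in auto)
  then show ?thesis by (rule that)
qed

theorem corollary3p4p2:
  fixes p :: "nat \<Rightarrow> complex poly" and D :: "complex set"
  assumes "guided p"
    and "open D" and "D \<noteq> {}"
    and "\<And>z. z \<in> D \<Longrightarrow>
           bdd_above ((\<lambda>n. 1 / real (degree (p n)) * log_plus (norm (poly (p n) z))) ` {1..})"
  shows "regular_set (filled_julia p) \<and>
         (\<forall>E. compact E \<and> regular_set E \<and> polynomially_convex E \<longrightarrow>
            uniform_limit UNIV (\<lambda>n. green (compos p n -` E)) (green (filled_julia p)) sequentially) \<and>
         uniformly_convergent_on UNIV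
           (\<lambda>n z. 1 / real (\<Prod>k=1..n. degree (p k)) * log_plus (norm (compos p n z)))"
proof -
  obtain C where "log_tame p C"
    using guided_log_tame[OF assms] by blast
  then interpret log_tame p C .
  have green_julia: "green (filled_julia p) = escape_rate" and reg: "regular_set (filled_julia p)"
    using green_like_imp_green[OF green_like_escape_rate] by (simp_all add: filled_julia_eq)
  have "uniform_limit UNIV (\<lambda>n. green (compos p n -` E)) escape_rate sequentially"
    if E: "regular_set E" "polynomially_convex E" for E
  proof -
    obtain B where B: "\<And>w. \<bar>green E w - log_plus (norm w)\<bar> \<le> B"
      using green_like_log_plus[OF green_like_green(1)[OF E]] by blast
    have "\<bar>green (compos p n -` E) z - escape_rate z\<bar> \<le> (B + 2 * C) / total_degree n" if n: "n \<ge> 1" for n z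
    proof -
      have "\<bar>1 / total_degree n * green E (compos p n z) - scaled_log n z\<bar>
              = 1 / total_degree n * \<bar>green E (compos p n z) - log_plus (norm (compos p n z))\<bar>"
        using total_degree_pos[of n] by (simp add: scaled_log_def abs_mult[symmetric] right_diff_distrib[symmetric] diff_divide_distrib[symmetric])
      also have "\<dots> \<le> 1 / total_degree n * B"
        using total_degree_pos[of n] B by (intro mult_left_mono) auto
      finally have "\<bar>1 / total_degree n * green E (compos p n z) - escape_rate z\<bar> \<le> 1 / total_degree n * B + 2 * C / total_degree n"
        using escape_rate_approx[OF n, of z] by linarith
      then show ?thesis
        by (simp add: green_preimage[OF E] add_divide_distrib)
    qed
    then show ?thesis by (rule uniform_limit_of_bound)
  qed
  moreover have "uniformly_convergent_on UNIV
           (\<lambda>n z. 1 / real (\<Prod>k=1..n. degree (p k)) * log_plus (norm (compos p n z)))"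
    using scaled_log_uniform_limit unfolding uniformly_convergent_on_def scaled_log_def total_degree_def by blast
  ultimately show ?thesis
    using reg by (simp add: green_julia)
qed

end
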